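(* Let $M\in\mathbb{N}$. Assume that a nonempty set $A\subset\mathbb{Z}_M$ satisfies (T1) and (T2), and that $M$ has at most two distinct prime divisors. Then $A(X)$ cannot have unsupported cyclotomic divisors.
   Context: $\mathbb{Z}_M=\mathbb{Z}/M\mathbb{Z}$. For $A\subset\mathbb{Z}_M$, represent its elements by integers in $\{0,1,\dots,M-1\}$; the mask polynomial is $A(X)=\sum_{a\in A}X^a$, considered modulo $X^M-1$. For $s\mid M$, divisibility of $A(X)$ by the $s$-th cyclotomic polynomial $\Phi_s(X)$ is well defined, since $\Phi_s\mid X^M-1$; all cyclotomic divisors $\Phi_s$ considered have $s\mid M$. $S_A^*$ is the set of all prime powers $p^\alpha>1$ (with $p^\alpha\mid M$) such that $\Phi_{p^\alpha}(X)\mid A(X)$. Conditions: (T1) $|A|=\prod_{s\in S_A^*}\Phi_s(1)$; (T2) if $s_1,\dots,s_k\in S_A^*$ are powers of distinct primes, then $\Phi_{s_1\cdots s_k}(X)$ divides $A(X)$. If $s\neq1$ and $\Phi_s\mid A$, then $\Phi_s$ is called an unsupported divisor of $A$ if (i) for every prime $p\mid s$ we have $p\mid |A|$, and (ii) for every prime power $p^\alpha$ with $p^\alpha\parallel s$ (i.e. $p$ is a prime dividing $s$, $p^\alpha\mid s$ and $p^{\alpha+1}\nmid s$), we have $\Phi_{p^\alpha}\nmid A$. *)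

theory Defs
  imports "HOL-Computational_Algebra.Computational_Algebra" "HOL-Number_Theory.Totient"
begin

definition cyclotomic_complex :: "nat \<Rightarrow> complex poly" where
  "cyclotomic_complex n = (\<Prod>k\<in>totatives n. [:- cis (2 * pi * real k / real n), 1:])"

text \<open>The polynomial above has integer coefficients. The lemma \<open>cyclotomic_poly\<close> below
  shows that the description used here has a (unique) solution for every positive index.\<close>

definition cyclotomic :: "nat \<Rightarrow> int poly" where
  "cyclotomic n = (THE p. map_poly of_int p = cyclotomic_complex n)"

text \<open>Elements of the cyclic group of order \<open>M\<close> are represented by their residues in
  \<open>{..<M}\<close>, so \<open>mask_poly A\<close> is the representative of degree less than \<open>M\<close> of the class
  modulo \<open>X ^ M - 1\<close>. Divisibility by \<open>cyclotomic s\<close>, \<open>s dvd M\<close>, is that of integer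
  polynomials.\<close>

definition mask_poly :: "nat set \<Rightarrow> int poly" where
  "mask_poly A = (\<Sum>a\<in>A. monom 1 a)"

definition prime_power_divisors :: "nat \<Rightarrow> nat set \<Rightarrow> nat set" where
  "prime_power_divisors M A =
     {s. s dvd M \<and> (\<exists>p k. prime p \<and> k > 0 \<and> s = p ^ k) \<and> cyclotomic s dvd mask_poly A}"

definition T1 :: "nat \<Rightarrow> nat set \<Rightarrow> bool" where
  "T1 M A \<longleftrightarrow> int (card A) = (\<Prod>s\<in>prime_power_divisors M A. poly (cyclotomic s) 1)"

text \<open>A family of powers of distinct primes is given by its set \<open>P\<close> of primes and the
  exponents \<open>e\<close>. The exponents are positive because 1 is not in \<open>prime_power_divisors M A\<close>.
  The empty family is excluded: its product is 1, and \<open>cyclotomic 1 = X - 1\<close> divides no mask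
  polynomial of a nonempty set.\<close>

definition T2 :: "nat \<Rightarrow> nat set \<Rightarrow> bool" where
  "T2 M A \<longleftrightarrow>
     (\<forall>P e. finite P \<and> P \<noteq> {} \<and> (\<forall>p\<in>P. prime p \<and> p ^ e p \<in> prime_power_divisors M A) \<longrightarrow>
        cyclotomic (\<Prod>p\<in>P. p ^ e p) dvd mask_poly A)"

definition unsupported_divisor :: "nat \<Rightarrow> nat set \<Rightarrow> nat \<Rightarrow> bool" where
  "unsupported_divisor M A s \<longleftrightarrow>
     s dvd M \<and> s \<noteq> 1 \<and> cyclotomic s dvd mask_poly A \<and>
     (\<forall>p. prime p \<and> p dvd s \<longrightarrow> p dvd card A) \<and>
     (\<forall>p k. prime p \<and> p dvd s \<and> p ^ k dvd s \<and> \<not> p ^ Suc k dvd s \<longrightarrow>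
        \<not> cyclotomic (p ^ k) dvd mask_poly A)"

subsection \<open>Integrality of the cyclotomic polynomials\<close>

lemma map_poly_of_int_add:
  "map_poly of_int (p + q) = (map_poly of_int p + map_poly of_int q :: complex poly)"
  by (intro poly_eqI) (simp add: coeff_map_poly)

lemma map_poly_of_int_mult:
  "map_poly of_int (p * q) = (map_poly of_int p * map_poly of_int q :: complex poly)"
  by (intro poly_eqI) (simp add: coeff_map_poly coeff_mult)

lemma map_poly_of_int_prod:
  "map_poly of_int (prod f S) = (\<Prod>x\<in>S. map_poly of_int (f x) :: complex poly)"
  by (induction S rule: infinite_finite_induct) (simp_all add: map_poly_of_int_mult)

lemma map_poly_of_int_inject:
  "map_poly of_int p = (map_poly of_int q :: complex poly) \<longleftrightarrow> p = q"
  by (auto simp: poly_eq_iff coeff_map_poly)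

lemma degree_map_poly_of_int: "degree (map_poly of_int p :: complex poly) = degree p"
  by (rule degree_map_poly) auto

lemma lead_coeff_cyclotomic_complex: "lead_coeff (cyclotomic_complex n) = 1"
  unfolding cyclotomic_complex_def by (simp add: lead_coeff_prod)

lemma prod_all_roots_of_unity:
  assumes "n > 0"
  shows "(\<Prod>k\<in>{0<..n}. [:- cis (2 * pi * real k / real n), 1:]) = monom 1 n - (1 :: complex poly)"
    (is "?L = ?R")
proof (rule poly_eqI_degree_lead_coeff)
  have dL: "degree ?L = n"
    by (subst degree_prod_eq_sum_degree) auto
  moreover have "lead_coeff ?L = 1" by (simp add: lead_coeff_prod)
  ultimately show "coeff ?L n = coeff ?R n"
    using assms by simp
  show "degree ?L \<le> n" using dL by simp
  show "degree ?R \<le> n" by (intro degree_diff_le) (auto simp: degree_monom_le)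
  show "n \<le> card {z::complex. z ^ n = 1}" using card_roots_unity_eq[OF assms] by simp
  fix z :: complex assume "z \<in> {z. z ^ n = 1}"
  hence z: "z ^ n = 1" by simp
  hence "z \<in> (\<lambda>k. cis (2 * pi * real k / real n)) ` {..<n}"
    using bij_betw_roots_unity[OF assms] by (simp add: bij_betw_def)
  then obtain k where k: "k < n" "z = cis (2 * pi * real k / real n)" by auto
  have "\<exists>j\<in>{0<..n}. z = cis (2 * pi * real j / real n)"
  proof (cases "k = 0")
    case True
    thus ?thesis using k assms by (intro bexI[of _ n]) auto
  next
    case False
    thus ?thesis using k by (intro bexI[of _ k]) auto
  qed
  hence "poly ?L z = 0" by (auto simp: poly_prod)
  thus "poly ?L z = poly ?R z" using z by (simp add: poly_monom)
qed

lemma prod_cyclotomic_complex: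
  assumes "n > 0"
  shows "(\<Prod>d\<in>{d. d dvd n}. cyclotomic_complex d) = monom 1 n - 1"
proof -
  have fin: "finite {d. d dvd n}" using assms by simp
  have "(\<Prod>d\<in>{d. d dvd n}. cyclotomic_complex d) =
        (\<Prod>(d, k)\<in>Sigma {d. d dvd n} totatives. [:- cis (2 * pi * real k / real d), 1:])"
    unfolding cyclotomic_complex_def using fin by (subst prod.Sigma) auto
  also have "\<dots> = (\<Prod>m\<in>{0<..n}. [:- cis (2 * pi * real m / real n), 1:])"
  proof (rule prod.reindex_bij_witness[of _ "\<lambda>m. (n div gcd m n, m div gcd m n)"
                                            "\<lambda>(d, k). k * (n div d)"], goal_cases)
    case (1 x)
    then obtain d k where x: "x = (d, k)" "d dvd n" "k \<in> totatives d" by auto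
    then obtain e where e: "n = d * e" by auto
    have pos: "d > 0" "e > 0" using e assms by auto
    have "gcd (k * e) (d * e) = e"
      using x gcd_mult_distrib_nat[of e k d] by (simp add: in_totatives_iff mult.commute)
    thus ?case using x e pos by simp
  next
    case (2 x)
    then obtain d k where x: "x = (d, k)" "d dvd n" "k \<in> totatives d" by auto
    then obtain e where e: "n = d * e" by auto
    have pos: "d > 0" "e > 0" using e assms by auto
    show ?case using x e pos by (simp add: in_totatives_iff)
  next
    case (3 m)
    define g where "g = gcd m n"
    have g: "g dvd m" "g dvd n" "g > 0" using assms by (auto simp: g_def)
    then obtain a b where ab: "m = g * a" "n = g * b" by (auto elim!: dvdE)
    show ?case unfolding g_def[symmetric] using ab g assms by simp
  next
    case (4 m)
    define g where "g = gcd m n"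
    have g: "g dvd m" "g dvd n" "g > 0" using assms by (auto simp: g_def)
    then obtain a b where ab: "m = g * a" "n = g * b" by (auto elim!: dvdE)
    have "coprime (m div g) (n div g)"
      unfolding g_def using assms by (intro div_gcd_coprime) auto
    thus ?case unfolding g_def[symmetric] using ab g assms 4 by (simp add: in_totatives_iff)
  next
    case (5 x)
    then obtain d k where x: "x = (d, k)" "d dvd n" "k \<in> totatives d" by auto
    then obtain e where e: "n = d * e" by auto
    have pos: "d > 0" "e > 0" using e assms by auto
    have div: "n div d = e" using e pos by simp
    have "2 * pi * real (k * e) / real n = 2 * pi * real k / real d"
      using e pos by (simp add: field_simps)
    thus ?case by (simp only: x(1) prod.case div)
  qed
  also have "\<dots> = monom 1 n - 1" by (rule prod_all_roots_of_unity[OF assms])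
  finally show ?thesis .
qed

lemma cyclotomic_complex_integral:
  assumes "n > 0"
  shows "\<exists>p :: int poly. map_poly of_int p = cyclotomic_complex n"
  using assms
proof (induction n rule: less_induct)
  case (less n)
  define D where "D = {d. d dvd n \<and> d \<noteq> n}"
  have D: "finite D" "{d. d dvd n} = insert n D" "n \<notin> D"
    using less.prems by (auto simp: D_def)
  have "\<forall>d\<in>D. \<exists>p :: int poly. map_poly of_int p = cyclotomic_complex d"
  proof
    fix d assume "d \<in> D"
    hence "d < n" "d > 0" using less.prems by (auto simp: D_def dest: dvd_imp_le intro: Nat.gr0I)
    thus "\<exists>p :: int poly. map_poly of_int p = cyclotomic_complex d" by (rule less.IH)
  qed
  then obtain f :: "nat \<Rightarrow> int poly"
    where f: "\<And>d. d \<in> D \<Longrightarrow> map_poly of_int (f d) = cyclotomic_complex d" by metis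
  define Q where "Q = prod f D"
  let ?c = "map_poly of_int :: int poly \<Rightarrow> complex poly"
  have Q: "?c Q = (\<Prod>d\<in>D. cyclotomic_complex d)"
    by (simp add: Q_def map_poly_of_int_prod f)
  have "lead_coeff (?c Q) = 1" by (simp add: Q lead_coeff_prod lead_coeff_cyclotomic_complex)
  hence lQ: "lead_coeff Q = 1" by (simp add: degree_map_poly_of_int coeff_map_poly)
  hence Q0: "Q \<noteq> 0" by auto
  define F :: "int poly" where "F = monom 1 n - 1"
  have F: "?c F = monom 1 n - 1"
    by (intro poly_eqI) (simp add: F_def coeff_map_poly)
  obtain S R where SR: "pseudo_divmod F Q = (S, R)" by force
  from pseudo_divmod[OF Q0 SR] lQ have FSR: "F = Q * S + R" and R: "R = 0 \<or> degree R < degree Q"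
    by auto
  have "?c F = ?c Q * cyclotomic_complex n"
    using prod_cyclotomic_complex[OF less.prems] D by (simp add: F Q mult.commute)
  hence eq: "?c R = ?c Q * (cyclotomic_complex n - ?c S)"
    by (simp add: FSR map_poly_of_int_add map_poly_of_int_mult algebra_simps)
  have "cyclotomic_complex n - ?c S = 0"
  proof (rule ccontr)
    assume nz: "cyclotomic_complex n - ?c S \<noteq> 0"
    have Qn: "?c Q \<noteq> 0" using \<open>lead_coeff (?c Q) = 1\<close> by auto
    have "degree (?c R) \<ge> degree (?c Q)" using nz Qn by (simp add: eq degree_mult_eq)
    moreover have "R \<noteq> 0" using eq nz Qn by auto
    ultimately show False using R by (simp add: degree_map_poly_of_int)
  qed
  thus ?case by auto
qed

lemma cyclotomic_poly:
  assumes "n > 0"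
  shows "map_poly of_int (cyclotomic n) = cyclotomic_complex n"
proof -
  have "\<exists>!p :: int poly. map_poly of_int p = cyclotomic_complex n"
    using cyclotomic_complex_integral[OF assms] map_poly_of_int_inject by metis
  thus ?thesis unfolding cyclotomic_def by (rule theI')
qed

end

theory Submission
  imports Defs
begin

text \<open>
  An unsupported divisor has index \<open>s = p ^ Suc i * q ^ Suc j\<close>, where \<open>M\<close> has the prime divisors
  \<open>p\<close> and \<open>q\<close>. Let \<open>E\<close> and \<open>F\<close> be the exponents (shifted by one) occurring in \<open>S\<^sub>A\<^sup>*\<close>, so that
  \<open>i \<notin> E\<close> and \<open>j \<notin> F\<close>.

  Take a set of residues modulo the full power of \<open>p\<close> in which the digits at positions in \<open>E\<close> are
  functions of the lower digits, and likewise for \<open>q\<close> and \<open>F\<close>. The Fourier transform of the product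
  of two such sets vanishes at every nontrivial frequency where (T2) does not force that of \<open>A\<close> to
  vanish, so by (T1) the product meets \<open>A\<close> in exactly one point. Hence two points of \<open>A\<close> that first differ in a digit outside \<open>E\<close>
  (or in none) and in a digit outside \<open>F\<close> (or in none) coincide.

  Divisibility by \<open>\<Phi>\<^sub>s\<close> says that the numbers of points of \<open>A\<close> in the \<open>p * q\<close> classes
  modulo \<open>s\<close> inside a class modulo \<open>p ^ i * q ^ j\<close> form a matrix \<open>x\<^sub>u + y\<^sub>v\<close>. A nonzero matrix of
  this kind with nonnegative entries has a row or a column without zero entries, say a column. By
  uniqueness that column contains everything nearby, and counting the choices of the remaining
  \<open>F\<close>-digits shows that \<open>p\<close> divides a power of \<open>q\<close>.
\<close>

subsection \<open>Digit trees and additive cell counts\<close>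

text \<open>Residues modulo \<open>p ^ n\<close> whose base-\<open>p\<close> digits at the positions in \<open>E\<close> are prescribed by
  \<open>\<phi>\<close> as functions of the lower digits, the other digits being free. Digits are counted from 0,
  so position \<open>i\<close> corresponds to \<open>\<Phi>\<close> of index \<open>p ^ Suc i\<close>.\<close>

primrec branch_set :: "nat \<Rightarrow> nat set \<Rightarrow> (nat \<Rightarrow> nat \<Rightarrow> nat) \<Rightarrow> nat \<Rightarrow> nat set" where
  "branch_set p E \<phi> 0 = {0}"
| "branch_set p E \<phi> (Suc n) =
     (\<lambda>(x, c). x + c * p ^ n) `
       Sigma (branch_set p E \<phi> n) (\<lambda>x. if n \<in> E then {\<phi> n x} else {..<p})"

lemma mod_power_mono:
  fixes x y p :: nat
  assumes "x mod p ^ n = y mod p ^ n" and "m \<le> n"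
  shows "x mod p ^ m = y mod p ^ m"
  using assms by (metis le_imp_power_dvd mod_mod_cancel)

lemma mod_power_Suc_eq_iff:
  fixes x y p :: nat
  assumes "p > 0"
  shows "x mod p ^ Suc n = y mod p ^ Suc n \<longleftrightarrow>
         x mod p ^ n = y mod p ^ n \<and> x div p ^ n mod p = y div p ^ n mod p"
proof
  assume *: "x mod p ^ Suc n = y mod p ^ Suc n"
  hence 1: "x mod p ^ n = y mod p ^ n" by (rule mod_power_mono) simp
  with * show "x mod p ^ n = y mod p ^ n \<and> x div p ^ n mod p = y div p ^ n mod p"
    using mod_mult2_eq[of x "p ^ n" p] mod_mult2_eq[of y "p ^ n" p] assms
    by (simp add: mult.commute)
next
  assume "x mod p ^ n = y mod p ^ n \<and> x div p ^ n mod p = y div p ^ n mod p"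
  thus "x mod p ^ Suc n = y mod p ^ Suc n"
    using mod_mult2_eq[of x "p ^ n" p] mod_mult2_eq[of y "p ^ n" p]
    by (simp add: mult.commute)
qed

lemma finite_branch_set [simp]: "finite (branch_set p E \<phi> n)"
  by (induction n) auto

lemma branch_set_less:
  assumes "\<And>n x. \<phi> n x < p" and "x \<in> branch_set p E \<phi> n"
  shows "x < p ^ n"
  using assms(2)
proof (induction n arbitrary: x)
  case (Suc n)
  then obtain y c where yc: "y \<in> branch_set p E \<phi> n" "x = y + c * p ^ n"
    and "c \<in> (if n \<in> E then {\<phi> n y} else {..<p})" by auto
  hence "c < p" using assms(1) by (auto split: if_splits)
  have "x < p ^ n + c * p ^ n" using Suc.IH[OF yc(1)] yc(2) by simp
  also have "\<dots> = Suc c * p ^ n" by simp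
  also have "\<dots> \<le> p * p ^ n" using \<open>c < p\<close> by (intro mult_right_mono) auto
  finally show ?case by simp
qed simp

lemma sum_branch_set_Suc:
  fixes h :: "nat \<Rightarrow> 'a :: comm_monoid_add"
  assumes "\<And>n x. \<phi> n x < p"
  shows "sum h (branch_set p E \<phi> (Suc n)) =
    (\<Sum>x\<in>branch_set p E \<phi> n. \<Sum>c\<in>(if n \<in> E then {\<phi> n x} else {..<p}). h (x + c * p ^ n))"
proof -
  have "inj_on (\<lambda>(x, c). x + c * p ^ n)
      (Sigma (branch_set p E \<phi> n) (\<lambda>x. if n \<in> E then {\<phi> n x} else {..<p}))"
  proof (rule inj_onI, clarify)
    fix x c y d
    assume "x \<in> branch_set p E \<phi> n" "y \<in> branch_set p E \<phi> n" and eq: "x + c * p ^ n = y + d * p ^ n"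
    hence less: "x < p ^ n" "y < p ^ n" using branch_set_less assms by blast+
    have "x = (x + c * p ^ n) mod p ^ n" using less by simp
    also have "\<dots> = y" unfolding eq using less by simp
    finally show "x = y \<and> c = d" using eq less assms[of 0 0] by auto
  qed
  thus ?thesis by (simp add: sum.reindex sum.Sigma case_prod_unfold)
qed

lemma card_branch_set:
  assumes "\<And>n x. \<phi> n x < p"
  shows "card (branch_set p E \<phi> n) = p ^ card ({..<n} - E)"
proof (induction n)
  case (Suc n)
  have "card (branch_set p E \<phi> (Suc n)) = (\<Sum>x\<in>branch_set p E \<phi> (Suc n). 1)"
    by (rule card_eq_sum)
  also have "\<dots> = (if n \<in> E then 1 else p) * card (branch_set p E \<phi> n)"
    by (subst sum_branch_set_Suc[OF assms]) simp
  finally have "card (branch_set p E \<phi> (Suc n)) =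
    (if n \<in> E then 1 else p) * card (branch_set p E \<phi> n)" .
  moreover have "{..<Suc n} - E = (if n \<in> E then {..<n} - E else insert n ({..<n} - E))"
    by (auto simp: lessThan_Suc)
  ultimately show ?case using Suc by simp
qed simp

lemma mod_mem_branch_set_iff:
  assumes "\<And>n x. \<phi> n x < p"
  shows "x mod p ^ a \<in> branch_set p E \<phi> a \<longleftrightarrow>
         (\<forall>n\<in>E. n < a \<longrightarrow> x div p ^ n mod p = \<phi> n (x mod p ^ n))"
proof (induction a)
  case (Suc a)
  have p: "p > 0" using assms[of 0 0] by simp
  have x: "x mod p ^ Suc a = x mod p ^ a + (x div p ^ a mod p) * p ^ a"
    using mod_mult2_eq[of x "p ^ a" p] by (simp add: mult.commute)
  have "x mod p ^ Suc a \<in> branch_set p E \<phi> (Suc a) \<longleftrightarrow>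
        x mod p ^ a \<in> branch_set p E \<phi> a \<and> (a \<in> E \<longrightarrow> x div p ^ a mod p = \<phi> a (x mod p ^ a))"
    (is "?L = ?R")
  proof
    assume ?L
    then obtain y c where yc: "y \<in> branch_set p E \<phi> a" "x mod p ^ Suc a = y + c * p ^ a"
       "c \<in> (if a \<in> E then {\<phi> a y} else {..<p})" by auto
    have y: "y < p ^ a" using branch_set_less[OF assms yc(1)] .
    have "c < p" using yc(3) assms by (auto split: if_splits)
    have "y = (y + c * p ^ a) mod p ^ a" using y by simp
    also have "\<dots> = x mod p ^ a" unfolding yc(2)[symmetric] x by simp
    finally have "y = x mod p ^ a" .
    moreover from this have "c = x div p ^ a mod p" using x yc(2) p by simp
    ultimately show ?R using yc by auto
  next
    assume ?R
    hence "(x mod p ^ a, x div p ^ a mod p) \<in>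
        Sigma (branch_set p E \<phi> a) (\<lambda>x. if a \<in> E then {\<phi> a x} else {..<p})"
      using p by simp
    thus ?L unfolding x branch_set.simps by (rule rev_image_eqI) simp
  qed
  thus ?case using Suc by (auto simp: less_Suc_eq)
qed simp

text \<open>The free digit at position \<open>i\<close> contributes a full geometric sum in
  \<open>z ^ p ^ i\<close>, a \<open>p\<close>-th root of unity other than 1. Higher digits do not
  affect \<open>z ^ x\<close> and only multiply the sum by 1 or \<open>p\<close>.\<close>

lemma sum_branch_set_root_eq_0:
  fixes z :: complex
  assumes "\<And>n x. \<phi> n x < p" and "i < a" and "i \<notin> E"
    and "z ^ p ^ Suc i = 1" and "z ^ p ^ i \<noteq> 1"
  shows "(\<Sum>x\<in>branch_set p E \<phi> a. z ^ x) = 0"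
proof -
  have "Suc i \<le> a" using assms by simp
  thus ?thesis
  proof (induction a rule: dec_induct)
    case base
    have "(\<Sum>c<p. z ^ (x + c * p ^ i)) = 0" for x
    proof -
      have "(\<Sum>c<p. z ^ (x + c * p ^ i)) = z ^ x * (\<Sum>c<p. (z ^ p ^ i) ^ c)"
        by (simp add: power_add power_mult[symmetric] sum_distrib_left mult.commute)
      also have "\<dots> = 0"
        using assms by (subst sum_gp_strict) (simp add: power_mult[symmetric] mult.commute)
      finally show ?thesis .
    qed
    thus ?case by (subst sum_branch_set_Suc[OF assms(1)]) (simp add: assms)
  next
    case (step n)
    have "z ^ p ^ n = (z ^ p ^ Suc i) ^ p ^ (n - Suc i)"
      using step by (simp only: power_mult[symmetric] power_add[symmetric]) simp
    hence "z ^ (c * p ^ n) = 1" for c using assms by (subst mult.commute) (simp add: power_mult)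
    hence "(\<Sum>x\<in>branch_set p E \<phi> (Suc n). z ^ x) =
       (if n \<in> E then 1 else of_nat p) * (\<Sum>x\<in>branch_set p E \<phi> n. z ^ x)"
      by (subst sum_branch_set_Suc[OF assms(1)]) (auto simp: power_add sum_distrib_left)
    thus ?case using step by simp
  qed
qed

text \<open>When \<open>card A = p ^ card E * q ^ card F\<close>, the required count is
  \<open>card A\<close> divided by \<open>p ^ card E' * q ^ card F'\<close>, as equidistribution
  would give. For \<open>E' = E\<close> and \<open>F' = F\<close> it is 1; a smaller
  \<open>E'\<close> serves to count points of which only low digits are fixed.\<close>

definition meets_branch_sets ::
    "nat \<Rightarrow> nat \<Rightarrow> nat set \<Rightarrow> nat \<Rightarrow> nat \<Rightarrow> nat set \<Rightarrow> nat set \<Rightarrow> bool" where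
  "meets_branch_sets p a E q b F A \<longleftrightarrow>
     (\<forall>E' F' \<phi> \<psi>. E' \<subseteq> E \<and> F' \<subseteq> F \<and> (\<forall>n x. \<phi> n x < p) \<and> (\<forall>n x. \<psi> n x < q) \<longrightarrow>
        card {x \<in> A. x mod p ^ a \<in> branch_set p E' \<phi> a \<and> x mod q ^ b \<in> branch_set q F' \<psi> b} =
        p ^ card (E - E') * q ^ card (F - F'))"

lemma meets_branch_sets_commute:
  assumes "meets_branch_sets p a E q b F A"
  shows "meets_branch_sets q b F p a E A"
  unfolding meets_branch_sets_def
proof (intro allI impI, elim conjE)
  fix F' E' and \<psi> \<phi> :: "nat \<Rightarrow> nat \<Rightarrow> nat"
  assume "F' \<subseteq> F" "E' \<subseteq> E" "\<forall>n x. \<psi> n x < q" "\<forall>n x. \<phi> n x < p"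
  hence "card {x \<in> A. x mod p ^ a \<in> branch_set p E' \<phi> a \<and> x mod q ^ b \<in> branch_set q F' \<psi> b} =
      p ^ card (E - E') * q ^ card (F - F')"
    using assms unfolding meets_branch_sets_def by blast
  thus "card {x \<in> A. x mod q ^ b \<in> branch_set q F' \<psi> b \<and> x mod p ^ a \<in> branch_set p E' \<phi> a} =
      q ^ card (F - F') * p ^ card (E - E')"
    by (simp add: conj_commute mult.commute)
qed

text \<open>The lowest base-\<open>p\<close> digit at which \<open>x\<close> and \<open>y\<close> differ, if any, lies outside \<open>E\<close>: exactly
  then some branch set contains both.\<close>

definition splits_outside :: "nat \<Rightarrow> nat set \<Rightarrow> nat \<Rightarrow> nat \<Rightarrow> bool" where
  "splits_outside p E x y \<longleftrightarrow>
     (\<forall>n\<in>E. x mod p ^ n = y mod p ^ n \<longrightarrow> x mod p ^ Suc n = y mod p ^ Suc n)"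

lemma splits_outside_branch_set:
  assumes "p > 0" and "splits_outside p E x y"
  obtains \<phi> where "\<And>n t. \<phi> n t < p"
    and "x mod p ^ a \<in> branch_set p E \<phi> a" and "y mod p ^ a \<in> branch_set p E \<phi> a"
proof
  \<comment> \<open>The pattern follows \<open>y\<close> along the residues of \<open>y\<close>, and
    \<open>x\<close> everywhere else. Where the residues agree, the next digits agree as well at
    positions in \<open>E\<close>, so \<open>x\<close> obeys it too.\<close>
  define \<phi> where "\<phi> = (\<lambda>n t. (if t = y mod p ^ n then y else x) div p ^ n mod p)"
  show *: "\<phi> n t < p" for n t using assms by (simp add: \<phi>_def)
  show "x mod p ^ a \<in> branch_set p E \<phi> a"
    unfolding mod_mem_branch_set_iff[of \<phi>, OF *] using assms(2)
    by (auto simp: \<phi>_def splits_outside_def mod_power_Suc_eq_iff[OF assms(1)] simp del: power_Suc)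
  show "y mod p ^ a \<in> branch_set p E \<phi> a"
    unfolding mod_mem_branch_set_iff[of \<phi>, OF *] by (auto simp: \<phi>_def)
qed

lemma meets_branch_sets_unique:
  assumes "meets_branch_sets p a E q b F A" and "p > 0" "q > 0"
    and "x \<in> A" "y \<in> A" and "splits_outside p E x y" and "splits_outside q F x y"
  shows "x = y"
proof -
  obtain \<phi> where \<phi>: "\<And>n t. \<phi> n t < p"
    "x mod p ^ a \<in> branch_set p E \<phi> a" "y mod p ^ a \<in> branch_set p E \<phi> a"
    using splits_outside_branch_set assms by metis
  obtain \<psi> where \<psi>: "\<And>n t. \<psi> n t < q"
    "x mod q ^ b \<in> branch_set q F \<psi> b" "y mod q ^ b \<in> branch_set q F \<psi> b"
    using splits_outside_branch_set assms by metis
  have "card {x \<in> A. x mod p ^ a \<in> branch_set p E \<phi> a \<and> x mod q ^ b \<in> branch_set q F \<psi> b} = 1"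
    using assms(1) \<phi>(1) \<psi>(1) by (simp add: meets_branch_sets_def)
  then obtain t where t: "{x \<in> A. x mod p ^ a \<in> branch_set p E \<phi> a \<and> x mod q ^ b \<in> branch_set q F \<psi> b} = {t}"
    by (rule card_1_singletonE)
  have "x \<in> {t}" "y \<in> {t}" unfolding t[symmetric] using \<phi> \<psi> assms(4,5) by auto
  thus ?thesis by simp
qed

section \<open>Counting points of \<open>A\<close> in classes modulo two prime powers\<close>

definition cell_count :: "nat \<Rightarrow> nat \<Rightarrow> nat set \<Rightarrow> nat \<Rightarrow> nat \<Rightarrow> nat" where
  "cell_count P Q A r v = card {x \<in> A. x mod P = r mod P \<and> x mod Q = v mod Q}"

lemma dvd_sum_lessThan_mult:
  fixes f :: "nat \<Rightarrow> nat"
  assumes "\<And>r. f (r mod m) = f r"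
  shows "p dvd (\<Sum>r<p * m. f r)"
proof -
  have "(\<Sum>r<p * m. f r) = (\<Sum>c<p. sum f {c * m..<c * m + m})"
    by (rule sum.nat_group[symmetric])
  also have "\<dots> = (\<Sum>c<p. \<Sum>r<m. f r)"
  proof (rule sum.cong[OF refl])
    fix c
    have "sum f {c * m..<c * m + m} = (\<Sum>r<m. f (r + c * m))"
      using sum.shift_bounds_nat_ivl[of f 0 "c * m" m] by (simp add: atLeast0LessThan add.commute)
    also have "\<dots> = (\<Sum>r<m. f r)"
      by (rule sum.cong) (use assms in \<open>metis mod_mult_self1\<close>)+
    finally show "sum f {c * m..<c * m + m} = (\<Sum>r<m. f r)" .
  qed
  finally show ?thesis by simp
qed

text \<open>View the counts as a matrix with rows modulo \<open>p ^ Suc i\<close> and columns modulo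
  \<open>q ^ Suc j\<close>; \<open>fibre\<close> says that the column of \<open>a0\<close> has no
  zero entry in the rows congruent to \<open>a0\<close> modulo \<open>p ^ i\<close>. Uniqueness
  forces the relevant points into this column, and additivity spreads them so evenly over the rows
  that \<open>p\<close> would divide a power of \<open>q\<close>.\<close>

lemma no_full_fibre:
  fixes p q :: nat
  assumes p: "prime p" and q: "prime q" and "p \<noteq> q" and A: "finite A"
    and E: "E \<subseteq> {..<a}" and F: "F \<subseteq> {..<b}"
    and hits: "meets_branch_sets p a E q b F A"
    and i: "i \<notin> E" and j: "j \<notin> F"
    and add: "\<And>r r' v v'. r mod p ^ i = r' mod p ^ i \<Longrightarrow> v mod q ^ j = v' mod q ^ j \<Longrightarrow>
       cell_count (p ^ Suc i) (q ^ Suc j) A r v + cell_count (p ^ Suc i) (q ^ Suc j) A r' v' =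
       cell_count (p ^ Suc i) (q ^ Suc j) A r v' + cell_count (p ^ Suc i) (q ^ Suc j) A r' v"
    and fibre: "\<And>r. r mod p ^ i = a0 mod p ^ i \<Longrightarrow> cell_count (p ^ Suc i) (q ^ Suc j) A r a0 > 0"
  shows False
proof -
  note [simp del] = power_Suc
  have p0: "p > 0" and q0: "q > 0" using p q prime_gt_0_nat by auto
  note pS = mod_power_Suc_eq_iff[OF p0] and qS = mod_power_Suc_eq_iff[OF q0]
  \<comment> \<open>Only digits below \<open>i\<close> are prescribed. As
    \<open>i \<notin> E\<close>, points of \<open>X\<close> in different classes modulo
    \<open>p ^ Suc i\<close> first differ at a position outside \<open>E\<close>.\<close>
  define X where "X = {x. \<forall>n\<in>E. n < i \<longrightarrow> x div p ^ n mod p = a0 div p ^ n mod p}"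
  have X_iff: "x \<in> X \<longleftrightarrow> y \<in> X" if "x mod p ^ i = y mod p ^ i" for x y
  proof -
    have "x div p ^ n mod p = y div p ^ n mod p" if "n < i" for n
      using mod_power_mono[OF \<open>x mod p ^ i = y mod p ^ i\<close>, of "Suc n"] that
      by (simp only: pS Suc_le_eq)
    thus ?thesis by (simp add: X_def)
  qed
  have X_row: "x \<in> X \<longleftrightarrow> y \<in> X"
    if "x mod p ^ Suc i = z mod p ^ Suc i" "y mod p ^ i = z mod p ^ i" for x y z
    using X_iff[of x y] mod_power_mono[OF that(1), of i] that(2) by simp
  have X_split: "splits_outside p E x y"
    if "x \<in> X" "y \<in> X" "x mod p ^ Suc i \<noteq> y mod p ^ Suc i" for x y
    unfolding splits_outside_def
  proof (intro ballI impI)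
    fix n assume n: "n \<in> E" "x mod p ^ n = y mod p ^ n"
    consider "n < i" | "n = i" | "Suc i \<le> n" by linarith
    thus "x mod p ^ Suc n = y mod p ^ Suc n"
    proof cases
      case 1 thus ?thesis using n that(1,2) by (simp only: pS) (simp add: X_def)
    next
      case 3 thus ?thesis using mod_power_mono[OF n(2)] that(3) by blast
    qed (use n i in auto)
  qed
  \<comment> \<open>If \<open>x\<close> were in another column, a point \<open>y\<close> of the
    column of \<open>a0\<close>, taken in a row other than that of \<open>x\<close>, would split
    from \<open>x\<close> outside both \<open>E\<close> and \<open>F\<close>, against
    uniqueness.\<close>
  have column: "x mod q ^ Suc j = a0 mod q ^ Suc j"
    if x: "x \<in> A" "x \<in> X" "splits_outside q F x a0" for x
  proof (rule ccontr)
    assume ne: "x mod q ^ Suc j \<noteq> a0 mod q ^ Suc j"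
    obtain r where r: "r mod p ^ i = a0 mod p ^ i" "r mod p ^ Suc i \<noteq> x mod p ^ Suc i"
    proof (cases "a0 mod p ^ Suc i = x mod p ^ Suc i")
      case True
      have "(a0 + p ^ i) mod p ^ Suc i \<noteq> a0 mod p ^ Suc i"
      proof
        assume "(a0 + p ^ i) mod p ^ Suc i = a0 mod p ^ Suc i"
        hence "p ^ Suc i dvd p ^ i" by (metis add_diff_cancel_left' le_add1 mod_eq_dvd_iff_nat)
        thus False using p by (metis Suc_n_not_le_n power_dvd_imp_le prime_gt_1_nat)
      qed
      with True show ?thesis by (intro that[of "a0 + p ^ i"]) auto
    qed (use that in auto)
    from fibre[OF r(1)] obtain y where y: "y \<in> A" "y mod p ^ Suc i = r mod p ^ Suc i"
      "y mod q ^ Suc j = a0 mod q ^ Suc j"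
      unfolding cell_count_def card_gt_0_iff by auto
    have "y mod p ^ i = a0 mod p ^ i" using mod_power_mono[OF y(2), of i] r by simp
    hence "y \<in> X" using X_iff[of y a0] by (simp add: X_def)
    hence 1: "splits_outside p E x y" using X_split x y r by auto
    have 2: "splits_outside q F x y"
      unfolding splits_outside_def
    proof (intro ballI impI)
      fix n assume n: "n \<in> F" "x mod q ^ n = y mod q ^ n"
      show "x mod q ^ Suc n = y mod q ^ Suc n"
      proof (cases "n \<le> j")
        case True
        hence "y mod q ^ Suc n = a0 mod q ^ Suc n" "y mod q ^ n = a0 mod q ^ n"
          using mod_power_mono[OF y(3)] by simp_all
        thus ?thesis using x(3) n unfolding splits_outside_def by metis
      next
        case False
        hence "x mod q ^ Suc j = y mod q ^ Suc j" using mod_power_mono[OF n(2)] by simp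
        thus ?thesis using y ne by simp
      qed
    qed
    from meets_branch_sets_unique[OF hits p0 q0 x(1) y(1) 1 2] show False using y r by simp
  qed

  \<comment> \<open>Each digit pattern \<open>g\<close> on \<open>F'\<close>, used inside the class of \<open>a0\<close> modulo \<open>q ^ Suc j\<close> only, yields
    a branch set; the points \<open>H g\<close> of \<open>A\<close> that it picks from \<open>X\<close> share one class \<open>h g\<close> modulo
    \<open>p ^ Suc i\<close>. By additivity \<open>p\<close> divides the number of patterns, which is a power of \<open>q\<close>.\<close>
  define F' where "F' = F \<inter> {j<..}"
  define G where "G = F' \<rightarrow>\<^sub>E {..<q}"
  \<comment> \<open>The reduction \<open>g n mod q\<close> keeps all values below \<open>q\<close>,
    so the facts on \<open>H g\<close> hold for arbitrary \<open>g\<close>.\<close>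
  define \<psi> where "\<psi> = (\<lambda>g n y. if n \<in> F' \<and> y mod q ^ Suc j = a0 mod q ^ Suc j then g n mod q
     else a0 div q ^ n mod q)"
  have \<psi>: "\<psi> g n y < q" for g n y using q0 by (simp add: \<psi>_def)
  define H where "H = (\<lambda>g. {x \<in> A. x \<in> X \<and> x mod q ^ b \<in> branch_set q F (\<psi> g) b})"
  have H_iff: "x \<in> H g \<longleftrightarrow> x \<in> A \<and> x \<in> X \<and> (\<forall>n\<in>F. x div q ^ n mod q = \<psi> g n (x mod q ^ n))"
    for x g
    using F unfolding H_def mem_Collect_eq mod_mem_branch_set_iff[of "\<psi> g", OF \<psi>] by auto
  define N where "N = p ^ card (E - (E \<inter> {..<i}))"
  have card_H: "card (H g) = N" for g
  proof -
    \<comment> \<open>This pattern ignores the residue and prescribes the digits of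
      \<open>a0\<close>, so that its branch set for \<open>E \<inter> {..<i}\<close> describes
      \<open>X\<close>.\<close>
    define \<phi> where "\<phi> = (\<lambda>n (_::nat). a0 div p ^ n mod p)"
    have \<phi>: "\<phi> n y < p" for n y using p0 by (simp add: \<phi>_def)
    have "x mod p ^ a \<in> branch_set p (E \<inter> {..<i}) \<phi> a \<longleftrightarrow> x \<in> X" for x
      using E by (subst mod_mem_branch_set_iff[of \<phi>, OF \<phi>]) (auto simp: X_def \<phi>_def)
    moreover have "card {x \<in> A. x mod p ^ a \<in> branch_set p (E \<inter> {..<i}) \<phi> a \<and>
        x mod q ^ b \<in> branch_set q F (\<psi> g) b} = N * q ^ card (F - F)"
      unfolding N_def
      using hits[unfolded meets_branch_sets_def, rule_format, of "E \<inter> {..<i}" F \<phi> "\<psi> g"] \<phi> \<psi>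
      by simp
    ultimately show ?thesis by (simp add: H_def)
  qed
  have N0: "N > 0" using p0 by (simp add: N_def)
  \<comment> \<open>A point outside the column agrees with \<open>a0\<close> at most modulo
    \<open>q ^ j\<close>, and up to there \<open>\<psi> g\<close> prescribes the digits of
    \<open>a0\<close>. It would thus split from \<open>a0\<close> outside \<open>F\<close>, and
    \<open>column\<close> applies.\<close>
  have H_column: "x mod q ^ Suc j = a0 mod q ^ Suc j" if "x \<in> H g" for x g
  proof (rule ccontr)
    assume ne: "x mod q ^ Suc j \<noteq> a0 mod q ^ Suc j"
    have "splits_outside q F x a0"
      unfolding splits_outside_def
    proof (intro ballI impI)
      fix n assume n: "n \<in> F" "x mod q ^ n = a0 mod q ^ n"
      hence "\<not> Suc j \<le> n" using mod_power_mono ne by blast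
      hence "n \<notin> F'" by (auto simp: F'_def)
      thus "x mod q ^ Suc n = a0 mod q ^ Suc n"
        using that n unfolding qS H_iff by (simp add: \<psi>_def)
    qed
    thus False using column[of x] that ne by (simp add: H_iff)
  qed
  have H_digit: "x div q ^ n mod q = g n mod q" if "x \<in> H g" "n \<in> F'" for x g n
  proof -
    have "x mod q ^ n mod q ^ Suc j = x mod q ^ Suc j"
      using that by (intro mod_mod_cancel le_imp_power_dvd) (simp add: F'_def)
    hence "\<psi> g n (x mod q ^ n) = g n mod q"
      using that(2) H_column[OF that(1)] by (simp add: \<psi>_def)
    moreover have "n \<in> F" using that(2) by (simp add: F'_def)
    ultimately show ?thesis using that(1) H_iff by simp
  qed
  \<comment> \<open>Two points of \<open>H g\<close> obey the same pattern on \<open>F\<close>; in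
    different rows they would also split outside \<open>E\<close>, by
    \<open>X_split\<close>.\<close>
  have H_row: "x mod p ^ Suc i = y mod p ^ Suc i" if "x \<in> H g" "y \<in> H g" for x y g
  proof (rule ccontr)
    assume ne: "x mod p ^ Suc i \<noteq> y mod p ^ Suc i"
    hence "splits_outside p E x y" using that X_split by (simp add: H_iff)
    moreover have "splits_outside q F x y"
      using that by (simp add: splits_outside_def qS H_iff)
    ultimately have "x = y"
      using meets_branch_sets_unique[OF hits p0 q0] that by (simp add: H_iff)
    with ne show False by simp
  qed
  have "\<exists>x. x \<in> H g" for g
    using card_H[of g] N0 by (metis card.empty equals0I less_irrefl)
  then obtain x\<^sub>0 where x0: "\<And>g. x\<^sub>0 g \<in> H g" by metis
  define h where "h = (\<lambda>g. x\<^sub>0 g mod p ^ Suc i)"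
  define Y where "Y = (\<lambda>r. {x \<in> A. x \<in> X \<and> x mod q ^ Suc j = a0 mod q ^ Suc j \<and>
                              x mod p ^ Suc i = r mod p ^ Suc i})"
  have finG: "finite G" using F finite_subset[of F "{..<b}"] by (auto simp: G_def F'_def intro!: finite_PiE)
  \<comment> \<open>The points of \<open>X\<close> in the column of \<open>a0\<close> are sorted by
    their digits at \<open>F'\<close>: each pattern \<open>g\<close> owns the \<open>N\<close>
    points of \<open>H g\<close>, all in the row \<open>h g\<close>.\<close>
  have card_Y: "card (Y r) = N * card {g \<in> G. h g = r mod p ^ Suc i}" for r
  proof -
    have "Y r = (\<Union>g\<in>{g \<in> G. h g = r mod p ^ Suc i}. H g)"
    proof (intro equalityI subsetI)
      fix x assume x: "x \<in> Y r"
      define g where "g = (\<lambda>n\<in>F'. x div q ^ n mod q)"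
      have "x div q ^ n mod q = \<psi> g n (x mod q ^ n)" if "n \<in> F" for n
      proof (cases "n \<in> F'")
        case True
        hence "x mod q ^ n mod q ^ Suc j = x mod q ^ Suc j"
          by (intro mod_mod_cancel le_imp_power_dvd) (simp add: F'_def)
        thus ?thesis using True x by (simp add: \<psi>_def g_def Y_def)
      next
        case False
        hence "Suc n \<le> Suc j" using that by (auto simp: F'_def)
        hence "x mod q ^ Suc n = a0 mod q ^ Suc n"
          using x mod_power_mono[of x q "Suc j" a0 "Suc n"] by (simp add: Y_def)
        thus ?thesis using False unfolding qS by (simp add: \<psi>_def)
      qed
      hence "x \<in> H g" using x by (simp add: H_iff Y_def)
      moreover have "g \<in> G" using q0 by (simp add: G_def g_def)
      moreover have "h g = r mod p ^ Suc i"
        using H_row[OF x0 \<open>x \<in> H g\<close>] x by (simp add: h_def Y_def)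
      ultimately show "x \<in> (\<Union>g\<in>{g \<in> G. h g = r mod p ^ Suc i}. H g)" by blast
    next
      fix x assume "x \<in> (\<Union>g\<in>{g \<in> G. h g = r mod p ^ Suc i}. H g)"
      then obtain g where g: "g \<in> G" "h g = r mod p ^ Suc i" "x \<in> H g" by blast
      thus "x \<in> Y r" using H_row[OF g(3) x0] H_column[OF g(3)]
        by (simp add: Y_def H_iff h_def)
    qed
    moreover have "card (\<Union>g\<in>{g \<in> G. h g = r mod p ^ Suc i}. H g) =
        (\<Sum>g\<in>{g \<in> G. h g = r mod p ^ Suc i}. card (H g))"
    proof (rule card_UN_disjoint)
      show "\<forall>g\<in>{g \<in> G. h g = r mod p ^ Suc i}. \<forall>g'\<in>{g \<in> G. h g = r mod p ^ Suc i}.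
          g \<noteq> g' \<longrightarrow> H g \<inter> H g' = {}"
      proof (intro ballI impI, rule ccontr)
        fix g g' assume g: "g \<in> {g \<in> G. h g = r mod p ^ Suc i}" "g' \<in> {g \<in> G. h g = r mod p ^ Suc i}"
          "g \<noteq> g'" "H g \<inter> H g' \<noteq> {}"
        then obtain x where x: "x \<in> H g" "x \<in> H g'" by blast
        have "g n = g' n" if "n \<in> F'" for n
        proof -
          have "g n mod q = g' n mod q"
            using H_digit[OF x(1) that] H_digit[OF x(2) that] by (rule trans[OF sym])
          moreover have "g n < q" "g' n < q" using g(1,2) that PiE_mem unfolding G_def by blast+
          ultimately show ?thesis by simp
        qed
        moreover have "g \<in> F' \<rightarrow>\<^sub>E {..<q}" "g' \<in> F' \<rightarrow>\<^sub>E {..<q}"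
          using g(1,2) by (simp_all add: G_def)
        ultimately have "g = g'" using PiE_ext by blast
        with g show False by simp
      qed
    qed (use finG A in \<open>auto simp: H_def\<close>)
    ultimately show ?thesis by (simp add: card_H mult.commute)
  qed
  have Y_cong: "card (Y r) = card (Y r')" if r: "r mod p ^ i = r' mod p ^ i" for r r'
  proof (cases "r \<in> X")
    case False
    hence "Y r = {}" "Y r' = {}" using X_row r unfolding Y_def by blast+
    thus ?thesis by simp
  next
    case True
    have inX: "x \<in> X"
      if "x mod p ^ Suc i = r mod p ^ Suc i \<or> x mod p ^ Suc i = r' mod p ^ Suc i" for x
      using X_row r True that by blast
    have Y_eq: "card (Y t) = cell_count (p ^ Suc i) (q ^ Suc j) A t a0" if "t = r \<or> t = r'" for t
    proof -
      have "Y t = {x \<in> A. x mod p ^ Suc i = t mod p ^ Suc i \<and> x mod q ^ Suc j = a0 mod q ^ Suc j}"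
        using inX that unfolding Y_def by blast
      thus ?thesis by (simp only: cell_count_def)
    qed
    \<comment> \<open>A second column with the same residue modulo \<open>q ^ j\<close>. A point
      there would split from \<open>a0\<close> at digit \<open>j\<close>, outside \<open>F\<close>,
      so by \<open>column\<close> it is empty in rows inside \<open>X\<close>; additivity then
      equates the two entries in the column of \<open>a0\<close>.\<close>
    define v where "v = a0 + q ^ j"
    have v: "v mod q ^ Suc j \<noteq> a0 mod q ^ Suc j"
    proof
      assume "v mod q ^ Suc j = a0 mod q ^ Suc j"
      hence "q ^ Suc j dvd q ^ j"
        unfolding v_def by (metis add_diff_cancel_left' le_add1 mod_eq_dvd_iff_nat)
      thus False using q by (metis Suc_n_not_le_n power_dvd_imp_le prime_gt_1_nat)
    qed
    have empty: "cell_count (p ^ Suc i) (q ^ Suc j) A t v = 0" if t: "t = r \<or> t = r'" for t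
    proof -
      have False if x: "x \<in> A" "x mod p ^ Suc i = t mod p ^ Suc i" "x mod q ^ Suc j = v mod q ^ Suc j" for x
      proof -
        have xj: "x mod q ^ j = a0 mod q ^ j"
          using mod_power_mono[OF x(3), of j] by (simp add: v_def)
        have ne: "x mod q ^ Suc j \<noteq> a0 mod q ^ Suc j" using v x by simp
        have "splits_outside q F x a0"
          unfolding splits_outside_def
        proof (intro ballI impI)
          fix n assume n: "n \<in> F" "x mod q ^ n = a0 mod q ^ n"
          hence "\<not> Suc j \<le> n" using mod_power_mono ne by blast
          moreover have "n \<noteq> j" using n j by auto
          ultimately show "x mod q ^ Suc n = a0 mod q ^ Suc n"
            using mod_power_mono[OF xj, of "Suc n"] by simp
        qed
        thus False using column[OF x(1) inX] x t ne by metis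
      qed
      hence "{x \<in> A. x mod p ^ Suc i = t mod p ^ Suc i \<and> x mod q ^ Suc j = v mod q ^ Suc j} = {}"
        by blast
      thus ?thesis by (simp only: cell_count_def card.empty)
    qed
    show ?thesis using add[of r r' v a0] r empty by (simp add: Y_eq v_def)
  qed
  \<comment> \<open>The number of patterns per row depends only on the row modulo
    \<open>p ^ i\<close>, so each value is repeated \<open>p\<close> times; the total is
    \<open>card G\<close>, a power of \<open>q\<close>.\<close>
  have "p dvd (\<Sum>r<p * p ^ i. card {g \<in> G. h g = r mod p ^ Suc i})"
  proof (rule dvd_sum_lessThan_mult)
    fix r
    have "card (Y (r mod p ^ i)) = card (Y r)" by (rule Y_cong) simp
    thus "card {g \<in> G. h g = r mod p ^ i mod p ^ Suc i} = card {g \<in> G. h g = r mod p ^ Suc i}"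
      unfolding card_Y using N0 by simp
  qed
  also have "(\<Sum>r<p * p ^ i. card {g \<in> G. h g = r mod p ^ Suc i}) =
      (\<Sum>r<p ^ Suc i. card {g \<in> G. h g = r})"
    by (rule sum.cong) (auto simp: power_Suc)
  also have "\<dots> = card G"
  proof -
    have "h ` G \<subseteq> {..<p ^ Suc i}"
      unfolding h_def using p0 by (intro image_subsetI) simp
    from sum.group[OF finG finite_lessThan this, of "\<lambda>_. 1::nat"] show ?thesis
      by (simp only: card_eq_sum)
  qed
  also have "card G = q ^ card F'"
    using F finite_subset[of F "{..<b}"] by (simp add: G_def card_PiE F'_def)
  finally have "p dvd q" by (rule prime_dvd_power[OF p])
  with primes_dvd_imp_eq[OF p q] \<open>p \<noteq> q\<close> show False by blast
qed

text \<open>The cell of a point \<open>a0\<close> of \<open>A\<close> is nonempty. If some entry of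
  its column vanishes, additivity makes every entry of its row at least as large as that of
  \<open>a0\<close>. So its column or its row is free of zeros, and the second case is the first
  with the primes exchanged.\<close>

lemma no_additive_cell:
  fixes p q :: nat
  assumes p: "prime p" and q: "prime q" and "p \<noteq> q" and A: "finite A" "A \<noteq> {}"
    and E: "E \<subseteq> {..<a}" and F: "F \<subseteq> {..<b}"
    and hits: "meets_branch_sets p a E q b F A"
    and i: "i \<notin> E" and j: "j \<notin> F"
    and add: "\<And>r r' v v'. r mod p ^ i = r' mod p ^ i \<Longrightarrow> v mod q ^ j = v' mod q ^ j \<Longrightarrow>
       cell_count (p ^ Suc i) (q ^ Suc j) A r v + cell_count (p ^ Suc i) (q ^ Suc j) A r' v' =
       cell_count (p ^ Suc i) (q ^ Suc j) A r v' + cell_count (p ^ Suc i) (q ^ Suc j) A r' v"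
  shows False
proof -
  let ?W = "cell_count (p ^ Suc i) (q ^ Suc j) A"
  obtain a0 where a0: "a0 \<in> A" using A by blast
  have pos: "?W a0 a0 > 0" using a0 A by (auto simp: cell_count_def card_gt_0_iff)
  have swap: "cell_count Q P A v r = cell_count P Q A r v" for P Q v r
    by (simp add: cell_count_def conj_commute)
  show False
  proof (cases "\<forall>r. r mod p ^ i = a0 mod p ^ i \<longrightarrow> ?W r a0 > 0")
    case True
    show False
      by (rule no_full_fibre[OF p q \<open>p \<noteq> q\<close> A(1) E F hits i j, of a0])
         (rule add, assumption+, use True in blast)
  next
    case False
    then obtain r where "r mod p ^ i = a0 mod p ^ i" and r2: "\<not> ?W r a0 > 0" by blast
    hence r: "a0 mod p ^ i = r mod p ^ i" by simp
    have "?W a0 v > 0" if "v mod q ^ j = a0 mod q ^ j" for v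
      using add[OF r that[symmetric]] pos r2 by linarith
    hence *: "cell_count (q ^ Suc j) (p ^ Suc i) A v a0 > 0" if "v mod q ^ j = a0 mod q ^ j" for v
      using that by (simp only: swap)
    show False
    proof (rule no_full_fibre[OF q p \<open>p \<noteq> q\<close>[symmetric] A(1) F E _ j i, of a0])
      show "meets_branch_sets q b F p a E A" by (rule meets_branch_sets_commute[OF hits])
      fix v v' r r' assume "v mod q ^ j = v' mod q ^ j" "r mod p ^ i = r' mod p ^ i"
      from add[OF this(2,1)]
      show "cell_count (q ^ Suc j) (p ^ Suc i) A v r + cell_count (q ^ Suc j) (p ^ Suc i) A v' r' =
            cell_count (q ^ Suc j) (p ^ Suc i) A v r' + cell_count (q ^ Suc j) (p ^ Suc i) A v' r"
        by (simp only: swap[of "q ^ Suc j"] add.commute)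
    qed (rule *)
  qed
qed

subsection \<open>Fourier analysis on cyclic groups and cyclotomic divisors\<close>

text \<open>Orthogonality of characters: multiplication by the primitive root \<open>w\<close>
  permutes the roots, so unless \<open>N dvd n\<close> the sum equals itself times
  \<open>w ^ n \<noteq> 1\<close>.\<close>

lemma sum_roots_unity_power:
  assumes "N > 0"
  shows "(\<Sum>z | z ^ N = 1. z ^ n) = (if N dvd n then of_nat N else (0 :: complex))"
proof (cases "N dvd n")
  case True
  hence "z ^ n = 1" if "z ^ N = 1" for z :: complex
    using that by (auto simp: power_mult)
  thus ?thesis using True card_roots_unity_eq[OF assms] by simp
next
  case False
  define w where "w = cis (2 * pi / real N)"
  have wN: "w ^ N = 1" using assms by (simp add: w_def DeMoivre)
  have wn: "w ^ n \<noteq> 1"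
  proof
    assume "w ^ n = 1"
    moreover have "w ^ n = w ^ (n mod N)"
      using wN by (metis mod_mult_div_eq mult.right_neutral power_add power_mult power_one)
    ultimately have "cis (2 * pi * real (n mod N) / real N) = cis (2 * pi * real 0 / real N)"
      by (simp add: w_def DeMoivre mult.commute)
    from inj_onD[OF bij_betw_imp_inj_on[OF bij_betw_roots_unity[OF assms]] this]
    have "n mod N = 0" using assms by simp
    with False show False by auto
  qed
  have "(\<Sum>z | z ^ N = 1. z ^ n) = (\<Sum>z | z ^ N = 1. (w * z) ^ n)"
  proof (rule sum.reindex_bij_witness[of _ "\<lambda>z. w * z" "\<lambda>z. z / w"])
    have "w \<noteq> 0" by (simp add: w_def)
    thus "w * (z / w) = z" "w * z / w = z" for z by simp_all
  qed (use wN in \<open>auto simp: power_mult_distrib power_divide w_def\<close>)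
  also have "\<dots> = w ^ n * (\<Sum>z | z ^ N = 1. z ^ n)"
    by (simp add: power_mult_distrib sum_distrib_left)
  finally have "(\<Sum>z | z ^ N = 1. z ^ n) = (0 :: complex)" using wn by simp
  thus ?thesis using False by simp
qed

text \<open>Frequencies are the roots of unity themselves rather than indices, so that they can be
  multiplied and their orders read off from powers such as \<open>z ^ p ^ i\<close>.\<close>

definition dft :: "nat \<Rightarrow> (nat \<Rightarrow> complex) \<Rightarrow> complex \<Rightarrow> complex" where
  "dft N f z = (\<Sum>y<N. f y * inverse z ^ y)"

lemma dft_inversion:
  assumes "N > 0"
  shows "of_nat N * f (x mod N) = (\<Sum>z | z ^ N = 1. dft N f z * z ^ x)"
proof -
  have "inverse z ^ y * z ^ x = z ^ ((N - 1) * y + x)" if "z ^ N = 1" for z :: complex and x y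
  proof -
    have "z * z ^ (N - 1) = 1" using that assms by (metis Suc_diff_1 power_Suc)
    hence "inverse z = z ^ (N - 1)" by (rule inverse_unique)
    thus ?thesis by (simp add: power_mult power_add)
  qed
  hence "(\<Sum>z | z ^ N = 1. dft N f z * z ^ x) =
      (\<Sum>z | z ^ N = 1. \<Sum>y<N. f y * z ^ ((N - 1) * y + x))"
    by (simp add: dft_def sum_distrib_right mult.assoc)
  also have "\<dots> = (\<Sum>y<N. f y * (\<Sum>z | z ^ N = 1. z ^ ((N - 1) * y + x)))"
    by (subst sum.swap) (simp add: sum_distrib_left)
  also have "\<dots> = (\<Sum>y<N. if y = x mod N then f y * of_nat N else 0)"
  proof (rule sum.cong[OF refl])
    fix y assume y: "y \<in> {..<N}"
    have "(N - 1) * y + x + y = x + N * y"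
      using assms by (cases N) auto
    hence "((N - 1) * y + x + y) mod N = x mod N" by (simp only: mod_mult_self2)
    hence "N dvd (N - 1) * y + x \<longleftrightarrow> y = x mod N"
      using y by (metis add_0 dvd_eq_mod_eq_0 mod_add_left_eq mod_less lessThan_iff
          add_diff_cancel_right' mod_eq_dvd_iff_nat le_add2)
    thus "f y * (\<Sum>z | z ^ N = 1. z ^ ((N - 1) * y + x)) = (if y = x mod N then f y * of_nat N else 0)"
      unfolding sum_roots_unity_power[OF assms] by simp
  qed
  also have "\<dots> = of_nat N * f (x mod N)"
    using assms by simp
  finally show ?thesis by simp
qed

text \<open>Fourier inversion in both factors leaves sums of \<open>(z * w) ^ x\<close> over
  \<open>A\<close>, which are values of the mask polynomial at roots of unity.\<close>

lemma sum_prod_eq_dft: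
  assumes "P > 0" and "Q > 0"
  shows "of_nat P * of_nat Q * (\<Sum>x\<in>A. f (x mod P) * g (x mod Q)) =
         (\<Sum>z | z ^ P = 1. \<Sum>w | w ^ Q = 1. dft P f z * dft Q g w * (\<Sum>x\<in>A. (z * w) ^ x))"
proof -
  have "of_nat P * of_nat Q * (\<Sum>x\<in>A. f (x mod P) * g (x mod Q)) =
        (\<Sum>x\<in>A. (of_nat P * f (x mod P)) * (of_nat Q * g (x mod Q)))"
    by (simp add: sum_distrib_left mult_ac)
  also have "\<dots> = (\<Sum>x\<in>A. \<Sum>z | z ^ P = 1. \<Sum>w | w ^ Q = 1. dft P f z * dft Q g w * (z * w) ^ x)"
    unfolding dft_inversion[OF assms(1)] dft_inversion[OF assms(2)]
    by (simp add: sum_product power_mult_distrib mult_ac)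
  also have "\<dots> = (\<Sum>z | z ^ P = 1. \<Sum>x\<in>A. \<Sum>w | w ^ Q = 1. dft P f z * dft Q g w * (z * w) ^ x)"
    by (rule sum.swap)
  also have "\<dots> = (\<Sum>z | z ^ P = 1. \<Sum>w | w ^ Q = 1. \<Sum>x\<in>A. dft P f z * dft Q g w * (z * w) ^ x)"
    by (rule sum.cong[OF refl], rule sum.swap)
  finally show ?thesis by (simp add: sum_distrib_left)
qed

section \<open>Roots of unity of prime power order and zeros of the mask polynomial\<close>

lemma power_eq_1_coprime:
  fixes z :: "'a :: monoid_mult"
  assumes "z ^ m = 1" and "z ^ n = 1" and "coprime m n"
  shows "z = 1"
proof (cases "m = 0")
  case False
  then obtain x y where "m * x = n * y + 1"
    using assms(3) bezout_nat[of m n] by (auto simp: coprime_iff_gcd_eq_1)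
  hence "z ^ (m * x) = z ^ (n * y) * z" by (simp add: power_add power_commutes)
  thus ?thesis using assms by (simp add: power_mult)
qed (use assms in auto)

lemma ex_prime_power_order:
  fixes z :: "'a :: monoid_mult"
  assumes "z ^ p ^ a = 1" and "z \<noteq> 1"
  obtains i where "i < a" and "z ^ p ^ i \<noteq> 1" and "z ^ p ^ Suc i = 1"
  using ex_least_nat_less[of "\<lambda>i. z ^ p ^ i = 1" a] assms
  by (metis power_0 power_one_right less_Suc_eq_le order_refl)

lemma poly_mask_poly:
  "poly (map_poly of_int (mask_poly A)) z = (\<Sum>a\<in>A. z ^ a :: complex)"
proof -
  have "map_poly of_int (mask_poly A) = (\<Sum>a\<in>A. monom 1 a :: complex poly)"
    by (rule poly_eqI) (auto simp: mask_poly_def coeff_map_poly coeff_sum intro!: sum.cong)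
  thus ?thesis by (simp add: poly_sum poly_monom)
qed

text \<open>By \<open>ord\<close> the order of \<open>z\<close> is exactly \<open>d\<close>: a
  common prime factor \<open>r\<close> of \<open>k\<close> and \<open>d\<close> would give
  \<open>z ^ (d div r) = 1\<close>. So \<open>z\<close> is a root of the cyclotomic polynomial of
  index \<open>d\<close>, hence of the mask polynomial.\<close>

lemma sum_power_eq_0_if_cyclotomic_dvd:
  fixes z :: complex
  assumes "cyclotomic d dvd mask_poly A" and "d > 1" and "z ^ d = 1"
    and ord: "\<And>r. prime r \<Longrightarrow> r dvd d \<Longrightarrow> z ^ (d div r) \<noteq> 1"
  shows "(\<Sum>a\<in>A. z ^ a) = 0"
proof -
  have "d > 0" using assms by simp
  from \<open>z ^ d = 1\<close> have "z \<in> (\<lambda>k. cis (2 * pi * real k / real d)) ` {..<d}"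
    using bij_betw_roots_unity[OF \<open>d > 0\<close>] by (simp add: bij_betw_def)
  then obtain k where k: "k < d" "z = cis (2 * pi * real k / real d)" by auto
  have "coprime k d"
  proof (rule ccontr)
    assume "\<not> coprime k d"
    then obtain r where r: "prime r" "r dvd k" "r dvd d"
      using coprime_iff_gcd_eq_1 prime_factor_nat by (metis gcd_greatest_iff)
    then obtain k' d' where kd: "k = r * k'" "d = r * d'" by (auto elim!: dvdE)
    have "r > 0" "d' > 0" using kd \<open>d > 0\<close> by auto
    hence "z ^ (d div r) = cis (2 * pi * real k')"
      using kd by (simp add: k DeMoivre field_simps)
    also have "\<dots> = 1" using cis_multiple_2pi[of "real k'"] by (simp add: mult_ac)
    finally show False using ord r by blast
  qed
  moreover from this have "k \<noteq> 0" using \<open>d > 1\<close> by (intro notI) auto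
  ultimately have "k \<in> totatives d" using k by (simp add: in_totatives_iff)
  hence "poly (cyclotomic_complex d) z = 0"
    by (auto simp: cyclotomic_complex_def poly_prod k)
  moreover obtain c where "mask_poly A = cyclotomic d * c" using assms by (elim dvdE)
  ultimately show ?thesis
    unfolding poly_mask_poly[symmetric]
    by (simp add: map_poly_of_int_mult cyclotomic_poly[OF \<open>d > 0\<close>])
qed

lemma sum_power_eq_0_prime_power:
  fixes z :: complex
  assumes "prime p" and "cyclotomic (p ^ Suc i) dvd mask_poly A"
    and "z ^ p ^ Suc i = 1" and "z ^ p ^ i \<noteq> 1"
  shows "(\<Sum>a\<in>A. z ^ a) = 0"
proof (rule sum_power_eq_0_if_cyclotomic_dvd[OF assms(2) _ assms(3)])
  show "1 < p ^ Suc i" using assms(1) prime_gt_1_nat by (intro one_less_power) auto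
  fix r assume "prime r" "r dvd p ^ Suc i"
  hence "r = p" using assms(1) prime_dvd_power primes_dvd_imp_eq by blast
  thus "z ^ (p ^ Suc i div r) \<noteq> 1" using assms prime_gt_0_nat by simp
qed

text \<open>The orders of \<open>z\<close> and \<open>w\<close> are coprime, so that of
  \<open>z * w\<close> is their product. In the test for \<open>r = p\<close> the factor from
  \<open>w\<close> is 1 and that from \<open>z\<close> is not, since a power of \<open>q\<close>
  cannot annihilate an element of order \<open>p\<close>.\<close>

lemma sum_power_eq_0_two_primes:
  fixes z w :: complex
  assumes pq: "prime p" "prime q" "p \<noteq> q"
    and "cyclotomic (p ^ Suc i * q ^ Suc j) dvd mask_poly A"
    and z: "z ^ p ^ Suc i = 1" "z ^ p ^ i \<noteq> 1" and w: "w ^ q ^ Suc j = 1" "w ^ q ^ j \<noteq> 1"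
  shows "(\<Sum>a\<in>A. (z * w) ^ a) = 0"
proof (rule sum_power_eq_0_if_cyclotomic_dvd[OF assms(4)])
  have pos: "p > 0" "q > 0" using pq prime_gt_0_nat by auto
  have cop: "coprime (p ^ m) (q ^ n)" for m n
    using primes_coprime[OF pq] by simp
  have "p ^ Suc i * q ^ Suc j \<ge> p ^ Suc i * 1" using pos by (intro mult_left_mono) auto
  moreover have "1 < p ^ Suc i" using pq prime_gt_1_nat by (intro one_less_power) auto
  ultimately show "1 < p ^ Suc i * q ^ Suc j" by linarith
  have z1: "z ^ (p ^ Suc i * n) = 1" and w1: "w ^ (q ^ Suc j * n) = 1" for n
    using z w by (simp_all only: power_mult power_one)
  show "(z * w) ^ (p ^ Suc i * q ^ Suc j) = 1"
    using z1[of "q ^ Suc j"] w1[of "p ^ Suc i"] by (simp only: power_mult_distrib mult.commute) simp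
  fix r assume r: "prime r" "r dvd p ^ Suc i * q ^ Suc j"
  hence "r dvd p ^ Suc i \<or> r dvd q ^ Suc j" by (simp only: prime_dvd_mult_iff)
  hence "r = p \<or> r = q" using r pq prime_dvd_power primes_dvd_imp_eq by blast
  thus "(z * w) ^ (p ^ Suc i * q ^ Suc j div r) \<noteq> 1"
  proof
    assume "r = p"
    hence "p ^ Suc i * q ^ Suc j div r = p ^ i * q ^ Suc j" using pos by (simp add: mult.assoc)
    moreover have "w ^ (p ^ i * q ^ Suc j) = 1" using w1[of "p ^ i"] by (simp only: mult.commute)
    moreover have "(z ^ p ^ i) ^ q ^ Suc j \<noteq> 1"
      using power_eq_1_coprime[of "z ^ p ^ i" p "q ^ Suc j"] z cop[of 1 "Suc j"]
      by (auto simp: power_mult[symmetric] mult.commute)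
    ultimately show ?thesis by (simp add: power_mult_distrib power_mult)
  next
    assume "r = q"
    hence "p ^ Suc i * q ^ Suc j div r = q ^ j * p ^ Suc i" using pos by (simp add: mult_ac)
    moreover have "z ^ (q ^ j * p ^ Suc i) = 1" using z1[of "q ^ j"] by (simp only: mult.commute)
    moreover have "(w ^ q ^ j) ^ p ^ Suc i \<noteq> 1"
      using power_eq_1_coprime[of "w ^ q ^ j" q "p ^ Suc i"] w cop[of "Suc i" 1]
      by (auto simp: power_mult[symmetric] mult.commute coprime_commute)
    ultimately show ?thesis by (simp add: power_mult_distrib power_mult)
  qed
qed

section \<open>Vanishing Fourier transforms and the resulting point counts\<close>

lemma dft_indicator_branch_set:
  assumes "\<And>n x. \<phi> n x < p" and "i < a" and "i \<notin> E"
    and "z ^ p ^ Suc i = 1" and "z ^ p ^ i \<noteq> 1"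
  shows "dft (p ^ a) (\<lambda>y. of_bool (y \<in> branch_set p E \<phi> a)) z = 0"
proof -
  have sub: "branch_set p E \<phi> a \<subseteq> {..<p ^ a}" using branch_set_less[of \<phi>] assms(1) by blast
  have "dft (p ^ a) (\<lambda>y. of_bool (y \<in> branch_set p E \<phi> a)) z = (\<Sum>y\<in>branch_set p E \<phi> a. inverse z ^ y)"
    unfolding dft_def using sub
    by (intro sum.mono_neutral_cong_right) auto
  also have "\<dots> = 0"
    using assms(4,5) by (intro sum_branch_set_root_eq_0[OF assms(1-3)]) (simp_all only: power_inverse inverse_eq_1_iff not_False_eq_True)
  finally show ?thesis .
qed

text \<open>Fourier expansion of the count. At a frequency other than \<open>(1, 1)\<close>, either
  the transform of a branch set vanishes, or the nontrivial orders come from \<open>E\<close> and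
  \<open>F\<close> and one of the divisibility hypotheses makes the mask polynomial vanish. Only
  \<open>h 1 1\<close> survives.\<close>

lemma meets_branch_setsI:
  assumes pq: "prime p" "prime q" "p \<noteq> q" and A: "finite A"
    and E: "E \<subseteq> {..<a}" and F: "F \<subseteq> {..<b}"
    and card: "card A = p ^ card E * q ^ card F"
    and dE: "\<And>i. i \<in> E \<Longrightarrow> cyclotomic (p ^ Suc i) dvd mask_poly A"
    and dF: "\<And>j. j \<in> F \<Longrightarrow> cyclotomic (q ^ Suc j) dvd mask_poly A"
    and dEF: "\<And>i j. i \<in> E \<Longrightarrow> j \<in> F \<Longrightarrow> cyclotomic (p ^ Suc i * q ^ Suc j) dvd mask_poly A"
  shows "meets_branch_sets p a E q b F A"
  unfolding meets_branch_sets_def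
proof (intro allI impI, elim conjE)
  fix E' F' and \<phi> \<psi> :: "nat \<Rightarrow> nat \<Rightarrow> nat"
  assume sub: "E' \<subseteq> E" "F' \<subseteq> F" and "\<forall>n x. \<phi> n x < p" "\<forall>n x. \<psi> n x < q"
  hence \<phi>: "\<And>n x. \<phi> n x < p" and \<psi>: "\<And>n x. \<psi> n x < q" by auto
  have pos: "p > 0" "q > 0" using pq prime_gt_0_nat by auto
  define S where "S = branch_set p E' \<phi> a"
  define T where "T = branch_set q F' \<psi> b"
  let ?f = "\<lambda>y. of_bool (y \<in> S) :: complex" and ?g = "\<lambda>y. of_bool (y \<in> T) :: complex"
  define h where "h = (\<lambda>z w. dft (p ^ a) ?f z * dft (q ^ b) ?g w * (\<Sum>x\<in>A. (z * w) ^ x))"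
  have h0: "h z w = 0" if z: "z ^ p ^ a = 1" and w: "w ^ q ^ b = 1" and ne: "\<not> (z = 1 \<and> w = 1)" for z w
  proof (rule ccontr)
    assume "h z w \<noteq> 0"
    hence nz: "dft (p ^ a) ?f z \<noteq> 0" "dft (q ^ b) ?g w \<noteq> 0" "(\<Sum>x\<in>A. (z * w) ^ x) \<noteq> 0"
      by (auto simp: h_def)
    have z': "\<exists>i\<in>E. z ^ p ^ Suc i = 1 \<and> z ^ p ^ i \<noteq> 1" if "z \<noteq> 1"
    proof -
      from ex_prime_power_order[OF z that]
      obtain i where i: "i < a" "z ^ p ^ i \<noteq> 1" "z ^ p ^ Suc i = 1" .
      hence "i \<in> E'" using dft_indicator_branch_set[of \<phi> p i a E' z, OF \<phi>] nz(1) unfolding S_def by blast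
      thus ?thesis using i sub by blast
    qed
    have w': "\<exists>j\<in>F. w ^ q ^ Suc j = 1 \<and> w ^ q ^ j \<noteq> 1" if "w \<noteq> 1"
    proof -
      from ex_prime_power_order[OF w that]
      obtain j where j: "j < b" "w ^ q ^ j \<noteq> 1" "w ^ q ^ Suc j = 1" .
      hence "j \<in> F'" using dft_indicator_branch_set[of \<psi> q j b F' w, OF \<psi>] nz(2) unfolding T_def by blast
      thus ?thesis using j sub by blast
    qed
    consider "z = 1" "w \<noteq> 1" | "z \<noteq> 1" "w = 1" | "z \<noteq> 1" "w \<noteq> 1" using ne by blast
    thus False
    proof cases
      case 1
      with w' obtain j where "j \<in> F" "w ^ q ^ Suc j = 1" "w ^ q ^ j \<noteq> 1" by blast
      from sum_power_eq_0_prime_power[OF pq(2) dF[OF this(1)] this(2,3)] show False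
        using nz(3) 1 by simp
    next
      case 2
      with z' obtain i where "i \<in> E" "z ^ p ^ Suc i = 1" "z ^ p ^ i \<noteq> 1" by blast
      from sum_power_eq_0_prime_power[OF pq(1) dE[OF this(1)] this(2,3)] show False
        using nz(3) 2 by simp
    next
      case 3
      with z' obtain i where i: "i \<in> E" "z ^ p ^ Suc i = 1" "z ^ p ^ i \<noteq> 1" by blast
      from 3 w' obtain j where j: "j \<in> F" "w ^ q ^ Suc j = 1" "w ^ q ^ j \<noteq> 1" by blast
      from sum_power_eq_0_two_primes[OF pq dEF[OF i(1) j(1)] i(2,3) j(2,3)] show False
        using nz(3) by simp
    qed
  qed
  have S: "S \<subseteq> {..<p ^ a}" and T: "T \<subseteq> {..<q ^ b}"
    using branch_set_less[of \<phi>, OF \<phi>] branch_set_less[of \<psi>, OF \<psi>] by (auto simp: S_def T_def)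
  define C where "C = {x \<in> A. x mod p ^ a \<in> S \<and> x mod q ^ b \<in> T}"
  have "of_nat (p ^ a) * of_nat (q ^ b) * (\<Sum>x\<in>A. ?f (x mod p ^ a) * ?g (x mod q ^ b)) =
      (\<Sum>z | z ^ p ^ a = 1. \<Sum>w | w ^ q ^ b = 1. h z w)"
    unfolding h_def using pos by (intro sum_prod_eq_dft) auto
  also have "\<dots> = (\<Sum>z | z ^ p ^ a = (1 :: complex). if z = 1 then h 1 1 else 0)"
  proof (rule sum.cong[OF refl])
    fix z assume z: "z \<in> {z::complex. z ^ p ^ a = 1}"
    have "(\<Sum>w | w ^ q ^ b = 1. h z w) = (\<Sum>w | w ^ q ^ b = (1 :: complex). if w = 1 then h z 1 else 0)"
      using z h0[of z] by (intro sum.cong) auto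
    also have "\<dots> = h z 1" using pos by (simp add: finite_roots_unity)
    also have "\<dots> = (if z = 1 then h 1 1 else 0)" using z h0[of z 1] by auto
    finally show "(\<Sum>w | w ^ q ^ b = 1. h z w) = (if z = 1 then h 1 1 else 0)" .
  qed
  also have "\<dots> = h 1 1" using pos by (simp add: finite_roots_unity)
  also have "h 1 1 = of_nat (card S) * of_nat (card T) * of_nat (card A)"
    using S T by (simp add: h_def dft_def sum_of_bool_eq Int_absorb1)
  also have "(\<Sum>x\<in>A. ?f (x mod p ^ a) * ?g (x mod q ^ b)) = (\<Sum>x\<in>A. of_bool (x \<in> C))"
    by (intro sum.cong) (auto simp: C_def)
  also have "\<dots> = of_nat (card C)"
    using A by (simp add: sum_of_bool_eq C_def Int_def)
  finally have "of_nat (p ^ a * q ^ b * card C) = (of_nat (card S * card T * card A) :: complex)"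
    by (simp only: of_nat_mult)
  hence eq: "p ^ a * q ^ b * card C = card S * card T * card A" by (simp only: of_nat_eq_iff)
  have split: "n = card ({..<n} - D') + card D'" "card D = card (D - D') + card D'"
    if "D' \<subseteq> D" "D \<subseteq> {..<n}" for D D' and n :: nat
  proof -
    have "finite D" "finite D'" using that finite_subset[of _ "{..<n}"] by auto
    thus "n = card ({..<n} - D') + card D'" "card D = card (D - D') + card D'"
      using that card_mono[of "{..<n}" D'] card_mono[of D D']
      by (auto simp: card_Diff_subset)
  qed
  have "p ^ a * q ^ b * card C =
      p ^ card ({..<a} - E') * q ^ card ({..<b} - F') * (p ^ card E * q ^ card F)"
    unfolding eq card S_def T_def card_branch_set[of \<phi>, OF \<phi>] card_branch_set[of \<psi>, OF \<psi>] ..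
  also have "\<dots> = p ^ (card ({..<a} - E') + card E') * q ^ (card ({..<b} - F') + card F') *
      (p ^ card (E - E') * q ^ card (F - F'))"
    using split(2)[OF sub(1) E] split(2)[OF sub(2) F] by (simp add: power_add mult_ac)
  also have "\<dots> = p ^ a * q ^ b * (p ^ card (E - E') * q ^ card (F - F'))"
    using split(1)[OF sub(1) E] split(1)[OF sub(2) F] by simp
  finally have "card C = p ^ card (E - E') * q ^ card (F - F')" using pos by simp
  thus "card {x \<in> A. x mod p ^ a \<in> branch_set p E' \<phi> a \<and> x mod q ^ b \<in> branch_set q F' \<psi> b} =
      p ^ card (E - E') * q ^ card (F - F')"
    by (simp add: C_def S_def T_def)
qed

text \<open>The alternating sum of the four counts is a sum over \<open>A\<close> of a product of
  two differences \<open>\<delta>\<close> of point masses. Their transforms vanish where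
  \<open>z ^ p ^ i = 1\<close> or \<open>w ^ q ^ j = 1\<close>, because the two points agree modulo
  the lower power; at the other frequencies \<open>dvd\<close> makes the sum over \<open>A\<close>
  vanish.\<close>

lemma cell_count_additive:
  assumes pq: "prime p" "prime q" "p \<noteq> q" and A: "finite A"
    and dvd: "cyclotomic (p ^ Suc i * q ^ Suc j) dvd mask_poly A"
    and r: "r mod p ^ i = r' mod p ^ i" and v: "v mod q ^ j = v' mod q ^ j"
  shows "cell_count (p ^ Suc i) (q ^ Suc j) A r v + cell_count (p ^ Suc i) (q ^ Suc j) A r' v' =
       cell_count (p ^ Suc i) (q ^ Suc j) A r v' + cell_count (p ^ Suc i) (q ^ Suc j) A r' v"
proof -
  have pos: "p > 0" "q > 0" using pq prime_gt_0_nat by auto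
  let ?W = "cell_count (p ^ Suc i) (q ^ Suc j) A"
  define \<delta> :: "nat \<Rightarrow> nat \<Rightarrow> nat \<Rightarrow> nat \<Rightarrow> complex"
    where "\<delta> = (\<lambda>N u u' y. of_bool (y = u mod N) - of_bool (y = u' mod N))"
  have dft: "dft (n ^ Suc k) (\<delta> (n ^ Suc k) u u') z = 0"
    if "n > 0" "u mod n ^ k = u' mod n ^ k" "z ^ n ^ k = 1" for n k u u' z
  proof -
    have red: "inverse z ^ (t mod n ^ Suc k) = inverse z ^ (t mod n ^ k)" for t
    proof -
      have "inverse z ^ (t mod n ^ Suc k) =
          inverse z ^ (n ^ k * (t mod n ^ Suc k div n ^ k) + t mod n ^ Suc k mod n ^ k)"
        by simp
      also have "t mod n ^ Suc k mod n ^ k = t mod n ^ k" by (simp add: mod_mod_cancel)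
      finally show ?thesis using that(3) by (simp add: power_add power_mult power_inverse)
    qed
    define N where "N = n ^ Suc k"
    have "dft N (\<delta> N u u') z = (\<Sum>y<N. if y = u mod N then inverse z ^ y else 0) -
        (\<Sum>y<N. if y = u' mod N then inverse z ^ y else 0)"
      unfolding dft_def \<delta>_def sum_subtractf[symmetric] by (intro sum.cong) auto
    also have "\<dots> = inverse z ^ (u mod N) - inverse z ^ (u' mod N)"
      using that(1) by (simp add: N_def del: power_Suc)
    also have "\<dots> = inverse z ^ (u mod n ^ k) - inverse z ^ (u' mod n ^ k)"
      unfolding N_def red ..
    also have "\<dots> = 0" using that(2) by simp
    finally show ?thesis unfolding N_def .
  qed
  have "of_nat (p ^ Suc i) * of_nat (q ^ Suc j) *
     (\<Sum>x\<in>A. \<delta> (p ^ Suc i) r r' (x mod p ^ Suc i) * \<delta> (q ^ Suc j) v v' (x mod q ^ Suc j)) = 0"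
  proof (subst sum_prod_eq_dft, goal_cases)
    case 3
    show ?case
    proof (intro sum.neutral ballI)
      fix z w :: complex
      assume "z \<in> {z. z ^ p ^ Suc i = 1}" "w \<in> {w. w ^ q ^ Suc j = 1}"
      hence zw: "z ^ p ^ Suc i = 1" "w ^ q ^ Suc j = 1" by simp_all
      show "dft (p ^ Suc i) (\<delta> (p ^ Suc i) r r') z * dft (q ^ Suc j) (\<delta> (q ^ Suc j) v v') w *
          (\<Sum>x\<in>A. (z * w) ^ x) = 0"
      proof (cases "z ^ p ^ i = 1 \<or> w ^ q ^ j = 1")
        case True
        thus ?thesis using dft[OF pos(1) r] dft[OF pos(2) v] by auto
      next
        case False
        thus ?thesis using sum_power_eq_0_two_primes[OF pq dvd zw(1) _ zw(2)] by simp
      qed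
    qed
  qed (use pos in auto)
  hence "(\<Sum>x\<in>A. \<delta> (p ^ Suc i) r r' (x mod p ^ Suc i) * \<delta> (q ^ Suc j) v v' (x mod q ^ Suc j)) = 0"
    using pos by simp
  also have "(\<Sum>x\<in>A. \<delta> (p ^ Suc i) r r' (x mod p ^ Suc i) * \<delta> (q ^ Suc j) v v' (x mod q ^ Suc j)) =
      (\<Sum>x\<in>A. of_bool (x mod p ^ Suc i = r mod p ^ Suc i \<and> x mod q ^ Suc j = v mod q ^ Suc j)) -
      (\<Sum>x\<in>A. of_bool (x mod p ^ Suc i = r mod p ^ Suc i \<and> x mod q ^ Suc j = v' mod q ^ Suc j)) -
      (\<Sum>x\<in>A. of_bool (x mod p ^ Suc i = r' mod p ^ Suc i \<and> x mod q ^ Suc j = v mod q ^ Suc j)) +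
      (\<Sum>x\<in>A. of_bool (x mod p ^ Suc i = r' mod p ^ Suc i \<and> x mod q ^ Suc j = v' mod q ^ Suc j))"
    unfolding sum_subtractf[symmetric] sum.distrib[symmetric] \<delta>_def
    by (intro sum.cong) (simp_all add: of_bool_conj algebra_simps)
  also have "\<dots> = of_nat (?W r v) - of_nat (?W r v') - of_nat (?W r' v) + of_nat (?W r' v')"
    using A by (simp add: cell_count_def sum_of_bool_eq Int_def del: power_Suc)
  finally have "of_nat (?W r v + ?W r' v') = (of_nat (?W r v' + ?W r' v) :: complex)"
    by (simp add: algebra_simps del: power_Suc)
  thus ?thesis by (simp only: of_nat_eq_iff)
qed

text \<open>The divisors of \<open>p ^ Suc k\<close> are itself and those of \<open>p ^ k\<close>,
  so the polynomial is the quotient of \<open>X ^ p ^ Suc k - 1\<close> by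
  \<open>X ^ p ^ k - 1\<close>, a sum of \<open>p\<close> powers of
  \<open>X ^ p ^ k\<close>.\<close>

lemma poly_cyclotomic_prime_power_1:
  assumes "prime p"
  shows "poly (cyclotomic (p ^ Suc k)) 1 = int p"
proof -
  have pos: "p > 0" "p > 1" using assms prime_gt_0_nat prime_gt_1_nat by auto
  have "{d. d dvd p ^ Suc k} = insert (p ^ Suc k) {d. d dvd p ^ k}"
    using assms by (auto simp: divides_primepow_nat le_Suc_eq simp del: power_Suc)
  moreover have "p ^ Suc k \<notin> {d. d dvd p ^ k}"
    using pos by (metis Suc_n_not_le_n mem_Collect_eq power_dvd_imp_le)
  ultimately have "monom 1 (p ^ Suc k) - 1 = cyclotomic_complex (p ^ Suc k) * (monom 1 (p ^ k) - 1)"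
    using prod_cyclotomic_complex[of "p ^ Suc k"] prod_cyclotomic_complex[of "p ^ k"] pos by simp
  moreover have "monom 1 (p ^ Suc k) - 1 = (\<Sum>c<p. monom 1 (p ^ k) ^ c) * (monom 1 (p ^ k) - 1 :: complex poly)"
    using power_diff_1_eq[of "monom 1 (p ^ k) :: complex poly" p]
    by (simp add: monom_power mult.commute)
  moreover have "monom 1 (p ^ k) - 1 \<noteq> (0 :: complex poly)"
  proof
    assume "monom 1 (p ^ k) - 1 = (0 :: complex poly)"
    hence "poly (monom 1 (p ^ k) - 1) 0 = (0 :: complex)" by simp
    thus False using pos by (simp add: poly_monom power_0_left)
  qed
  ultimately have "cyclotomic_complex (p ^ Suc k) = (\<Sum>c<p. monom 1 (p ^ k) ^ c)"
    by simp
  hence "poly (cyclotomic_complex (p ^ Suc k)) 1 = of_nat p"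
    by (simp add: poly_sum poly_monom)
  moreover have "poly (map_poly of_int P) 1 = complex_of_int (poly P 1)" for P :: "int poly"
    by (induction P) (simp_all add: map_poly_pCons)
  ultimately have "complex_of_int (poly (cyclotomic (p ^ Suc k)) 1) = of_int (int p)"
    using cyclotomic_poly[of "p ^ Suc k"] pos by (metis of_int_of_nat_eq zero_less_power)
  thus ?thesis by (simp only: of_int_eq_iff)
qed

subsection \<open>Two prime divisors\<close>

lemma prime_factorization_two_primes:
  fixes n :: nat
  assumes "n > 0" and "prime_factors n = {p, q}" and "p \<noteq> q"
  shows "n = p ^ multiplicity p n * q ^ multiplicity q n"
proof -
  have "n = (\<Prod>r\<in>prime_factors n. r ^ multiplicity r n)"
    by (rule prime_factorization_nat[OF assms(1)])
  thus ?thesis using assms(2,3) by simp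
qed

lemma prime_power_divisors_two_primes:
  assumes M: "M > 0" "prime_factors M = {p, q}"
  shows "prime_power_divisors M A =
     (\<lambda>i. p ^ Suc i) ` {i. i < multiplicity p M \<and> cyclotomic (p ^ Suc i) dvd mask_poly A} \<union>
     (\<lambda>j. q ^ Suc j) ` {j. j < multiplicity q M \<and> cyclotomic (q ^ Suc j) dvd mask_poly A}"
    (is "_ = ?R")
proof (intro equalityI subsetI)
  have dvd_iff: "r ^ k dvd M \<longleftrightarrow> k \<le> multiplicity r M" if "prime r" for r k
    using M that by (intro power_dvd_iff_le_multiplicity) auto
  have pq: "prime p" "prime q"
    using M in_prime_factors_imp_prime[of _ M] by auto
  {
    fix s assume "s \<in> prime_power_divisors M A"
    then obtain r k where s: "s = r ^ k" "prime r" "k > 0" "s dvd M" "cyclotomic s dvd mask_poly A"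
      by (auto simp: prime_power_divisors_def)
    hence "r dvd M" using dvd_trans[OF dvd_power[of k r]] by auto
    hence "r \<in> {p, q}" using M s by (auto simp: prime_factors_dvd simp flip: M(2))
    moreover obtain i where "k = Suc i" using s(3) by (cases k) auto
    moreover from this have "i < multiplicity r M" using s dvd_iff by (simp add: Suc_le_eq del: power_Suc)
    ultimately show "s \<in> ?R" using s(1,5) by blast
  }
  fix s assume "s \<in> ?R"
  thus "s \<in> prime_power_divisors M A"
  proof
    assume "s \<in> (\<lambda>i. p ^ Suc i) ` {i. i < multiplicity p M \<and> cyclotomic (p ^ Suc i) dvd mask_poly A}"
    then obtain i where i: "s = p ^ Suc i" "i < multiplicity p M" "cyclotomic s dvd mask_poly A" by blast
    hence "s dvd M" using dvd_iff[OF pq(1)] by (simp add: Suc_le_eq del: power_Suc)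
    thus ?thesis using i pq unfolding prime_power_divisors_def by blast
  next
    assume "s \<in> (\<lambda>j. q ^ Suc j) ` {j. j < multiplicity q M \<and> cyclotomic (q ^ Suc j) dvd mask_poly A}"
    then obtain i where i: "s = q ^ Suc i" "i < multiplicity q M" "cyclotomic s dvd mask_poly A" by blast
    hence "s dvd M" using dvd_iff[OF pq(2)] by (simp add: Suc_le_eq del: power_Suc)
    thus ?thesis using i pq unfolding prime_power_divisors_def by blast
  qed
qed

lemma T1_two_primes:
  assumes "prime p" "prime q" "p \<noteq> q" and "finite E" "finite F"
    and "prime_power_divisors M A = (\<lambda>i. p ^ Suc i) ` E \<union> (\<lambda>j. q ^ Suc j) ` F"
    and "T1 M A"
  shows "card A = p ^ card E * q ^ card F"
proof -
  have inj: "inj_on (\<lambda>i. r ^ Suc i) D" if "prime r" for r :: nat and D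
    using prime_gt_1_nat[OF that] by (auto intro!: inj_onI simp del: power_Suc)
  have disj: "(\<lambda>i. p ^ Suc i) ` E \<inter> (\<lambda>j. q ^ Suc j) ` F = {}"
  proof -
    have False if "p ^ Suc i = q ^ Suc j" for i j
    proof -
      have "p dvd q ^ Suc j" unfolding that[symmetric] by simp
      thus False using assms(1-3) prime_dvd_power primes_dvd_imp_eq by blast
    qed
    thus ?thesis by blast
  qed
  have "int (card A) = (\<Prod>s\<in>(\<lambda>i. p ^ Suc i) ` E \<union> (\<lambda>j. q ^ Suc j) ` F. poly (cyclotomic s) 1)"
    using assms(6,7) by (simp only: T1_def)
  also have "\<dots> = (\<Prod>i\<in>E. poly (cyclotomic (p ^ Suc i)) 1) * (\<Prod>j\<in>F. poly (cyclotomic (q ^ Suc j)) 1)"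
    using assms(4,5) disj inj[OF assms(1)] inj[OF assms(2)]
    by (subst prod.union_disjoint) (simp_all only: finite_imageI prod.reindex o_def)
  also have "\<dots> = int (p ^ card E * q ^ card F)"
    using assms(1,2) by (simp only: poly_cyclotomic_prime_power_1) simp
  finally show ?thesis by (simp only: of_nat_eq_iff)
qed

lemma T2_two_primes:
  assumes "T2 M A" and "prime p" "prime q" "p \<noteq> q"
    and "p ^ i \<in> prime_power_divisors M A" and "q ^ j \<in> prime_power_divisors M A"
  shows "cyclotomic (p ^ i * q ^ j) dvd mask_poly A"
proof -
  have "cyclotomic (\<Prod>r\<in>{p, q}. r ^ (if r = p then i else j)) dvd mask_poly A"
    using assms(1)[unfolded T2_def, rule_format, of "{p, q}" "\<lambda>r. if r = p then i else j"] assms(2-)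
    by auto
  thus ?thesis using assms(4) by auto
qed

theorem theorem1p12:
  fixes M :: nat and A :: "nat set"
  assumes "M > 0"
    and "A \<subseteq> {..<M}" and "A \<noteq> {}"
    and "T1 M A" and "T2 M A"
    and "card (prime_factors M) \<le> 2"
  shows "\<not> (\<exists>s. unsupported_divisor M A s)"
proof
  assume "\<exists>s. unsupported_divisor M A s"
  then obtain s where s: "s dvd M" "s \<noteq> 1" "cyclotomic s dvd mask_poly A"
    and unsupp: "\<And>p k. prime p \<Longrightarrow> p dvd s \<Longrightarrow> p ^ k dvd s \<Longrightarrow> \<not> p ^ Suc k dvd s \<Longrightarrow>
        \<not> cyclotomic (p ^ k) dvd mask_poly A"
    unfolding unsupported_divisor_def by blast
  have s0: "s > 0" using s(1) \<open>M > 0\<close> by (auto intro: Nat.gr0I)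
  have unsupp': "\<not> cyclotomic (p ^ multiplicity p s) dvd mask_poly A" if "prime p" "p dvd s" for p
  proof (rule unsupp[OF that])
    have "p ^ k dvd s \<longleftrightarrow> k \<le> multiplicity p s" for k
      using s0 that(1) by (intro power_dvd_iff_le_multiplicity) auto
    thus "p ^ multiplicity p s dvd s" "\<not> p ^ Suc (multiplicity p s) dvd s" by (simp_all del: power_Suc)
  qed
  obtain p where p: "prime p" "p dvd s" using s(2) prime_factor_nat by blast
  obtain x where x: "s = p ^ multiplicity p s * x" "\<not> p dvd x"
    using s0 p(1) by (elim multiplicity_decompose'[of s p, rotated 2]) auto
  \<comment> \<open>If \<open>s\<close> were a prime power, condition (ii) would exclude the divisor
    of index \<open>s\<close> itself; hence \<open>s\<close> has a second prime factor.\<close>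
  have "x \<noteq> 1"
  proof
    assume "x = 1"
    hence "s = p ^ multiplicity p s" using x(1) by simp
    thus False using unsupp'[OF p] s(3) by simp
  qed
  then obtain q where q: "prime q" "q dvd x" using prime_factor_nat by blast
  have "p \<noteq> q" using q x(2) by blast
  have "q dvd s" by (subst x(1)) (use q(2) in simp)
  have sub: "{p, q} \<subseteq> prime_factors s"
    using p q \<open>q dvd s\<close> s0 by (simp add: prime_factors_dvd)
  have "prime_factors s \<subseteq> prime_factors M"
    using s(1) \<open>M > 0\<close> by (intro dvd_prime_factors) auto
  moreover from this sub have "{p, q} = prime_factors M"
    using assms(6) \<open>p \<noteq> q\<close> by (intro card_seteq) auto
  ultimately have pf: "prime_factors M = {p, q}" "prime_factors s = {p, q}" using sub by auto

  have "multiplicity p s > 0" "multiplicity q s > 0"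
    using p q \<open>q dvd s\<close> s0 by (simp_all add: prime_multiplicity_gt_zero_iff)
  then obtain i j where ij: "multiplicity p s = Suc i" "multiplicity q s = Suc j"
    by (metis gr0_implies_Suc)
  have s_eq: "s = p ^ Suc i * q ^ Suc j"
    using prime_factorization_two_primes[OF s0 pf(2) \<open>p \<noteq> q\<close>] by (simp only: ij)

  define E where "E = {i. i < multiplicity p M \<and> cyclotomic (p ^ Suc i) dvd mask_poly A}"
  define F where "F = {j. j < multiplicity q M \<and> cyclotomic (q ^ Suc j) dvd mask_poly A}"
  have sub: "E \<subseteq> {..<multiplicity p M}" "F \<subseteq> {..<multiplicity q M}" by (auto simp: E_def F_def)
  hence fin: "finite E" "finite F" using finite_subset by blast+
  have ppd: "prime_power_divisors M A = (\<lambda>i. p ^ Suc i) ` E \<union> (\<lambda>j. q ^ Suc j) ` F"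
    unfolding E_def F_def by (rule prime_power_divisors_two_primes[OF \<open>M > 0\<close> pf(1)])
  have finA: "finite A" using assms(2) finite_subset by blast
  have "meets_branch_sets p (multiplicity p M) E q (multiplicity q M) F A"
  proof (rule meets_branch_setsI[OF p(1) q(1) \<open>p \<noteq> q\<close> finA sub])
    show "card A = p ^ card E * q ^ card F"
      by (rule T1_two_primes[OF p(1) q(1) \<open>p \<noteq> q\<close> fin ppd assms(4)])
    show "cyclotomic (p ^ Suc i * q ^ Suc j) dvd mask_poly A" if "i \<in> E" "j \<in> F" for i j
      by (rule T2_two_primes[OF assms(5) p(1) q(1) \<open>p \<noteq> q\<close>]) (use that ppd in blast)+
  qed (simp_all only: E_def F_def mem_Collect_eq)
  \<comment> \<open>Since \<open>p ^ Suc i\<close> and \<open>q ^ Suc j\<close> are the exact prime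
    powers in \<open>s\<close>, condition (ii) excludes both exponents.\<close>
  moreover have "i \<notin> E" "j \<notin> F"
    using unsupp'[OF p] unsupp'[OF q(1) \<open>q dvd s\<close>] by (simp_all only: ij E_def F_def mem_Collect_eq simp_thms)
  ultimately show False
    using cell_count_additive[OF p(1) q(1) \<open>p \<noteq> q\<close> finA s(3)[unfolded s_eq]]
    by (intro no_additive_cell[OF p(1) q(1) \<open>p \<noteq> q\<close> finA assms(3) sub])
qed

end
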